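(* For $0<\sigma<2$ let $L^\sigma$ be the probability density on $\mathbb{R}$ whose Fourier transform is $\widehat{L^\sigma}(\xi)=e^{-|\xi|^\sigma}$, and for $y>0$ let $L^\sigma_y(x)=y^{-1}L^\sigma(y^{-1}x)$. Then the maximal operator \[L^*f(x)=\sup_{y>0,\,0<\sigma<2}|(L^\sigma_y\ast f)(x)|\] is of weak type $(1,1)$ on $\mathbb{R}$ and bounded on $L^p(\mathbb{R})$ for $1<p\leq\infty$.
   Context: An operator $T$ is of weak type $(1,1)$ if there is $C>0$ with $|\{x:|Tf(x)|>\lambda\}|\leq C\lambda^{-1}\|f\|_1$ for all $f\in L^1(\mathbb{R})$ and $\lambda>0$; it is bounded on $L^p$ if $\|Tf\|_p\leq C\|f\|_p$. *)

theory Defs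
  imports "HOL-Analysis.Analysis"
begin

definition stable_density :: "real \<Rightarrow> (real \<Rightarrow> real) \<Rightarrow> bool" where
  "stable_density \<sigma> g \<longleftrightarrow>
     g \<in> borel_measurable lborel \<and> (\<forall>x. 0 \<le> g x) \<and> integrable lborel g \<and>
     (\<integral>x. g x \<partial>lborel) = 1 \<and>
     (\<forall>\<xi>::real. (CLBINT x. exp (- (\<i> * complex_of_real (\<xi> * x))) * complex_of_real (g x))
                   = complex_of_real (exp (- (\<bar>\<xi>\<bar> powr \<sigma>))))"

definition dilate :: "(real \<Rightarrow> real) \<Rightarrow> real \<Rightarrow> real \<Rightarrow> real" where
  "dilate g y x = (1 / y) * g (x / y)"

definition conv :: "(real \<Rightarrow> real) \<Rightarrow> (real \<Rightarrow> real) \<Rightarrow> real \<Rightarrow> real" where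
  "conv g f x = (\<integral>t. g (x - t) * f t \<partial>lborel)"

definition Lstar :: "(real \<Rightarrow> real \<Rightarrow> real) \<Rightarrow> (real \<Rightarrow> real) \<Rightarrow> real \<Rightarrow> ennreal" where
  "Lstar L f x = (SUP p \<in> {0<..} \<times> {0<..<2}.
       ennreal \<bar>conv (dilate (L (snd p)) (fst p)) f x\<bar>)"

end

theory Submission
  imports Defs "HOL-Probability.Probability" "HOL-Real_Asymp.Real_Asymp"
begin

text \<open>
  Every density \<open>L\<^sup>\<sigma>\<close> is even and decreasing in \<open>\<bar>x\<bar>\<close>, so each \<open>L\<^sup>\<sigma>\<^sub>y\<close> is an average of normalised
  indicators of symmetric intervals and \<open>\<bar>L\<^sup>\<sigma>\<^sub>y * f\<bar>\<close> is bounded pointwise by the Hardy-Littlewood maximal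
  function of \<open>f\<close>, uniformly in \<open>\<sigma>\<close> and \<open>y\<close>.

  Monotonicity holds because \<open>L\<^sup>\<sigma>\<close> is a mixture of centred Gaussians. With \<open>\<alpha> = \<sigma> / 2 < 1\<close>, the
  binomial series gives \<open>(1 - exp (- \<epsilon> r))\<^sup>\<alpha> = 1 - (\<Sum>k\<ge>1. c\<^sub>k exp (- k \<epsilon> r))\<close> with \<open>c\<^sub>k \<ge> 0\<close>; scaling,
  exponentiating and letting \<open>\<epsilon>\<close> tend to \<open>0\<close> shows that \<open>exp (- r\<^sup>\<alpha>)\<close> is a limit of nonnegative
  combinations of exponentials \<open>exp (- s r)\<close>. Putting \<open>r = \<xi>\<^sup>2\<close> and inverting the Fourier transform
  turns these into Gaussians.
\<close>

subsection \<open>Mixtures of exponentials\<close>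

text \<open>
  Up to the values at \<open>r \<le> 0\<close>, which are irrelevant, these are the Laplace transforms of finite
  measures on \<open>[0, \<infinity>)\<close>; the inductive description avoids constructing the representing measure.
\<close>

inductive exp_mixture :: "(real \<Rightarrow> real) \<Rightarrow> bool" where
  exp: "0 \<le> s \<Longrightarrow> exp_mixture (\<lambda>r. exp (- (s * r)))"
| lincomb: "exp_mixture u \<Longrightarrow> exp_mixture v \<Longrightarrow> 0 \<le> a \<Longrightarrow> 0 \<le> b \<Longrightarrow>
    exp_mixture (\<lambda>r. a * u r + b * v r)"
| lim: "(\<And>n::nat. exp_mixture (u n)) \<Longrightarrow> (\<And>n r. 0 < r \<Longrightarrow> u n r \<le> B) \<Longrightarrow>
    (\<And>r. 0 < r \<Longrightarrow> (\<lambda>n. u n r) \<longlonglongrightarrow> v r) \<Longrightarrow> exp_mixture v"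

text \<open>Both properties pass through every constructor. In the case \<open>lim\<close> the bound
  survives because one \<open>B\<close> serves the whole sequence; the same \<open>B\<close> later
  supplies the dominating functions.\<close>

lemma exp_mixture_bounds:
  assumes "exp_mixture u"
  obtains B where "\<And>r. 0 < r \<Longrightarrow> 0 \<le> u r" "\<And>r. 0 < r \<Longrightarrow> u r \<le> B"
proof -
  have "\<exists>B. \<forall>r>0. 0 \<le> u r \<and> u r \<le> B"
    using assms
  proof induction
    case (exp s)
    then show ?case by (intro exI[of _ 1]) auto
  next
    case (lincomb u v a b)
    then obtain B C where "\<forall>r>0. 0 \<le> u r \<and> u r \<le> B" "\<forall>r>0. 0 \<le> v r \<and> v r \<le> C"
      by blast
    with lincomb show ?case
      by (intro exI[of _ "a * B + b * C"]) (auto intro!: add_mono mult_left_mono)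
  next
    case (lim u B v)
    have "0 \<le> v r \<and> v r \<le> B" if "r > 0" for r
      using lim that by (intro conjI LIMSEQ_le_const[OF lim(3)] LIMSEQ_le_const2[OF lim(3)]) blast+
    then show ?case by blast
  qed
  with that show ?thesis by blast
qed

section \<open>Closure properties of mixtures\<close>

text \<open>The rule \<open>lim\<close> inspects only \<open>r > 0\<close>, so the constant sequence
  \<open>u\<close> converges to every function that agrees with \<open>u\<close> there.\<close>

lemma exp_mixture_cong:
  assumes "exp_mixture u" "\<And>r. 0 < r \<Longrightarrow> u r = v r"
  shows "exp_mixture v"
proof -
  obtain B where B: "\<And>r. 0 < r \<Longrightarrow> u r \<le> B"
    using exp_mixture_bounds[OF assms(1)] by metis
  show ?thesis
    by (rule exp_mixture.lim[where u = "\<lambda>_. u" and B = B]) (auto simp: assms(2)[symmetric] intro: assms(1) B)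
qed

text \<open>For the underlying measures this is convolution. Two inductions replace it: first over
  \<open>u\<close> against a single exponential, then over \<open>v\<close> with \<open>u\<close>
  fixed.\<close>

lemma exp_mixture_mult:
  assumes "exp_mixture u" "exp_mixture v"
  shows "exp_mixture (\<lambda>r. u r * v r)"
proof -
  have times_exp: "exp_mixture (\<lambda>r. u r * exp (- (s * r)))" if "0 \<le> s" for s
    using assms(1)
  proof induction
    case (exp t)
    have "(\<lambda>r. exp (- (t * r)) * exp (- (s * r))) = (\<lambda>r. exp (- ((t + s) * r)))"
      by (auto simp: algebra_simps simp flip: exp_add)
    with exp that show ?case
      using exp_mixture.exp[of "t + s"] by simp
  next
    case (lincomb u v a b)
    then show ?case
      using exp_mixture.lincomb[OF lincomb(5,6,3,4)] by (simp add: algebra_simps)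
  next
    case (lim u B v)
    show ?case
    proof (rule exp_mixture.lim[where u = "\<lambda>n r. u n r * exp (- (s * r))" and B = B])
      fix n and r :: real assume "0 < r"
      have "0 \<le> u n r" "u n r \<le> B"
        using exp_mixture_bounds[OF lim(1)[of n]] \<open>0 < r\<close> lim(2) by blast+
      moreover have "exp (- (s * r)) \<le> 1" using that \<open>0 < r\<close> by simp
      ultimately show "u n r * exp (- (s * r)) \<le> B"
        by (meson mult_left_le order_trans)
    qed (auto intro!: tendsto_intros lim)
  qed
  obtain C where C: "\<And>r. 0 < r \<Longrightarrow> 0 \<le> u r" "\<And>r. 0 < r \<Longrightarrow> u r \<le> C"
    using exp_mixture_bounds[OF assms(1)] by metis
  show ?thesis
    using assms(2)
  proof induction
    case (exp s)
    then show ?case by (rule times_exp)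
  next
    case (lincomb v w a b)
    then show ?case
      using exp_mixture.lincomb[OF lincomb(5,6,3,4)] by (simp add: algebra_simps)
  next
    case (lim v B w)
    show ?case
    proof (rule exp_mixture.lim[where u = "\<lambda>n r. u r * v n r" and B = "C * B"])
      fix n and r :: real assume r: "0 < r"
      have "0 \<le> v n r"
        using exp_mixture_bounds[OF lim(1)[of n]] r by metis
      then show "u r * v n r \<le> C * B"
        using C[OF r] lim(2)[OF r, of n] by (intro mult_mono) auto
    qed (auto intro!: tendsto_intros lim)
  qed
qed

lemma exp_mixture_power: "exp_mixture u \<Longrightarrow> exp_mixture (\<lambda>r. u r ^ n)"
proof (induction n)
  case 0
  then show ?case using exp_mixture.exp[of 0] by simp
qed (simp add: exp_mixture_mult)

lemma exp_mixture_cmult: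
  assumes "exp_mixture u" "0 \<le> a"
  shows "exp_mixture (\<lambda>r. a * u r)"
  using exp_mixture.lincomb[OF assms(1) assms(1) assms(2), of 0] by simp

lemma exp_mixture_sum:
  assumes "finite I" "\<And>i. i \<in> I \<Longrightarrow> exp_mixture (u i)" "\<And>i. i \<in> I \<Longrightarrow> 0 \<le> a i"
  shows "exp_mixture (\<lambda>r. \<Sum>i\<in>I. a i * u i r)"
  using assms
proof (induction I)
  case empty
  then show ?case
    using exp_mixture_cmult[OF exp_mixture.exp[of 0], of 0] by simp
next
  case (insert i I)
  then show ?case
    using exp_mixture.lincomb[of "u i" "\<lambda>r. \<Sum>i\<in>I. a i * u i r" "a i" 1] by simp
qed

text \<open>The terms are nonnegative, so all partial sums lie below the full sum and inherit its
  bound, which is the common bound that \<open>lim\<close> asks for.\<close>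

lemma exp_mixture_suminf:
  assumes "\<And>k::nat. exp_mixture (u k)" "\<And>k. 0 \<le> a k"
    and "\<And>r. 0 < r \<Longrightarrow> (\<lambda>k. a k * u k r) sums v r" "\<And>r. 0 < r \<Longrightarrow> v r \<le> B"
  shows "exp_mixture v"
proof (rule exp_mixture.lim[where u = "\<lambda>n r. \<Sum>k<n. a k * u k r" and B = B])
  fix n and r :: real assume r: "0 < r"
  have "0 \<le> a k * u k r" for k
    using exp_mixture_bounds[OF assms(1)[of k]] assms(2)[of k] r by (blast intro: mult_nonneg_nonneg)
  then have "(\<Sum>k<n. a k * u k r) \<le> v r"
    using assms(3)[OF r] sum_le_suminf[of "\<lambda>k. a k * u k r" "{..<n}"] by (simp add: sums_iff)
  then show "(\<Sum>k<n. a k * u k r) \<le> B"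
    using assms(4)[OF r] by linarith
next
  show "exp_mixture (\<lambda>r. \<Sum>k<n. a k * u k r)" for n
    by (intro exp_mixture_sum assms) auto
qed (use assms(3) in \<open>simp add: sums_def\<close>)

text \<open>The exponential series has nonnegative coefficients, and powers of a mixture are
  mixtures.\<close>

lemma exp_mixture_exp:
  assumes "exp_mixture u" "0 \<le> t"
  shows "exp_mixture (\<lambda>r. exp (t * u r))"
proof -
  obtain B where B: "\<And>r. 0 < r \<Longrightarrow> 0 \<le> u r" "\<And>r. 0 < r \<Longrightarrow> u r \<le> B"
    using exp_mixture_bounds[OF assms(1)] by metis
  show ?thesis
  proof (rule exp_mixture_suminf[where u = "\<lambda>k r. u r ^ k" and a = "\<lambda>k. t ^ k / fact k" and B = "exp (t * B)"])
    show "(\<lambda>k. t ^ k / fact k * u r ^ k) sums exp (t * u r)" for r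
      using exp_converges[of "t * u r"] by (simp add: power_mult_distrib divide_inverse mult_ac)
  qed (use assms B in \<open>auto intro: exp_mixture_power mult_left_mono\<close>)
qed

section \<open>The function exp (- r powr \<alpha>) as a mixture\<close>

text \<open>Passing from index \<open>Suc k\<close> to \<open>Suc (Suc k)\<close> multiplies the
  coefficient by \<open>(a - Suc k) / Suc (Suc k)\<close>, which is negative because
  \<open>a < 1\<close>; the signs therefore alternate, starting from the positive value
  \<open>a\<close>.\<close>

lemma gbinomial_sign:
  fixes a :: real
  assumes "0 < a" "a < 1"
  shows "(-1) ^ k * (a gchoose Suc k) \<ge> 0"
proof (induction k)
  case 0
  then show ?case using assms by simp
next
  case (Suc k)
  have "(a gchoose Suc (Suc k)) = (a gchoose Suc k) * (a - Suc k) / Suc (Suc k)"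
    using gbinomial_mult_1[of a "Suc k"] by (simp add: field_simps)
  then have "(-1) ^ Suc k * (a gchoose Suc (Suc k))
      = ((-1) ^ k * (a gchoose Suc k)) * ((Suc k - a) / Suc (Suc k))"
    by (simp only: power_Suc) (simp only: times_divide_eq_right, simp add: algebra_simps)
  moreover have "0 \<le> (Suc k - a) / Suc (Suc k)" using assms by simp
  ultimately show ?case using Suc by (metis mult_nonneg_nonneg)
qed

text \<open>This is the binomial series of \<open>(1 - z) powr \<alpha>\<close> at
  \<open>z = exp (- (\<epsilon> * r))\<close>: powers of \<open>z\<close> are again exponentials in
  \<open>r\<close>, and after the constant term all coefficients of the series have one
  sign.\<close>

lemma exp_mixture_one_minus_powr:
  fixes \<alpha> \<epsilon> :: real
  assumes \<alpha>: "0 < \<alpha>" "\<alpha> < 1" and \<epsilon>: "0 < \<epsilon>"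
  shows "exp_mixture (\<lambda>r. 1 - (1 - exp (- (\<epsilon> * r))) powr \<alpha>)"
proof (rule exp_mixture_suminf[where u = "\<lambda>k r. exp (- ((\<epsilon> * Suc k) * r))"
      and a = "\<lambda>k. (-1) ^ k * (\<alpha> gchoose Suc k)" and B = 1])
  fix r :: real assume r: "0 < r"
  define z where "z = exp (- (\<epsilon> * r))"
  have z: "0 < z" "z < 1" using r \<epsilon> by (auto simp: z_def)
  have "(\<lambda>k. (\<alpha> gchoose k) * (- z) ^ k) sums (1 - z) powr \<alpha>"
    using gen_binomial_real[of "- z" \<alpha>] z by simp
  \<comment> \<open>The term of index 0 equals 1 and moves to the right-hand side, which shifts all
    indices by one.\<close>
  then have "(\<lambda>k. (\<alpha> gchoose Suc k) * (- z) ^ Suc k) sums ((1 - z) powr \<alpha> - 1)"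
    by (subst (asm) sums_iff_shift'[of _ 1, symmetric, simplified]) simp
  then have "(\<lambda>k. - ((\<alpha> gchoose Suc k) * (- z) ^ Suc k)) sums (1 - (1 - z) powr \<alpha>)"
    using sums_minus by fastforce
  moreover have "- ((\<alpha> gchoose Suc k) * (- z) ^ Suc k) = (-1) ^ k * (\<alpha> gchoose Suc k) * exp (- ((\<epsilon> * Suc k) * r))" for k
  proof -
    have "exp (- ((\<epsilon> * Suc k) * r)) = z ^ Suc k"
      unfolding z_def by (simp add: exp_of_nat_mult[symmetric] algebra_simps del: power_Suc)
    then show ?thesis by (simp add: power_minus[of z])
  qed
  ultimately show "(\<lambda>k. (-1) ^ k * (\<alpha> gchoose Suc k) * exp (- ((\<epsilon> * Suc k) * r))) sums (1 - (1 - exp (- (\<epsilon> * r))) powr \<alpha>)"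
    unfolding z_def by (simp only:)
qed (use \<epsilon> gbinomial_sign[OF \<alpha>] in \<open>auto intro!: exp_mixture.exp\<close>)

text \<open>With \<open>N = Suc n\<close>, the quantity \<open>N * (1 - exp (- r / N))\<close> tends
  to \<open>r\<close>, so it suffices to treat exp of minus its power \<alpha>.\<close>

lemma exp_mixture_exp_minus_powr:
  fixes \<alpha> :: real
  assumes \<alpha>: "0 < \<alpha>" "\<alpha> < 1"
  shows "exp_mixture (\<lambda>r. exp (- (r powr \<alpha>)))"
proof (rule exp_mixture.lim[where B = 1])
  define u where "u n r = exp (- ((Suc n * (1 - exp (- (1 / Suc n * r)))) powr \<alpha>))" for n and r :: real
  \<comment> \<open>Adding and subtracting \<open>Suc n powr \<alpha>\<close> in the exponent turns
    the negative multiple of a power into a positive multiple of a mixture, at the price of a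
    positive constant factor.\<close>
  have u_eq: "u n r = exp (- (Suc n powr \<alpha>)) * exp (Suc n powr \<alpha> * (1 - (1 - exp (- (1 / Suc n * r))) powr \<alpha>))"
    if "0 < r" for n r
  proof -
    have "(Suc n * (1 - exp (- (1 / Suc n * r)))) powr \<alpha> = Suc n powr \<alpha> * (1 - exp (- (1 / Suc n * r))) powr \<alpha>"
      using that by (intro powr_mult)
    then show ?thesis
      unfolding u_def by (simp add: right_diff_distrib flip: exp_add)
  qed
  show "exp_mixture (u n)" for n
    by (rule exp_mixture_cong[OF _ u_eq[symmetric]])
      (intro exp_mixture_cmult exp_mixture_exp exp_mixture_one_minus_powr \<alpha>; simp)
  show "u n r \<le> 1" for n r by (simp add: u_def)
  fix r :: real assume r: "0 < r"
  have "(\<lambda>n. real (Suc n) * (1 - exp (- (1 / real (Suc n) * r)))) \<longlonglongrightarrow> r"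
    using r by real_asymp
  then show "(\<lambda>n. u n r) \<longlonglongrightarrow> exp (- (r powr \<alpha>))"
    unfolding u_def using r \<alpha> by (intro tendsto_intros) auto
qed

subsection \<open>Unimodality of the inverse Fourier transform\<close>

lemma abs_cos_mult_le: "\<bar>cos y * z\<bar> \<le> \<bar>z\<bar>" for y z :: real
  by (simp add: abs_mult mult_left_le_one_le)

text \<open>The cosine integral is the real part of the characteristic function of the standard
  normal law, up to a linear substitution.\<close>

lemma gaussian_cos_transform:
  fixes c x :: real
  assumes c: "0 < c"
  shows "(LBINT \<xi>. cos (x * \<xi>) * exp (- (c * \<xi>\<^sup>2))) = sqrt (pi / c) * exp (- (x\<^sup>2 / (4 * c)))"
    and "integrable lborel (\<lambda>\<xi>. exp (- (c * \<xi>\<^sup>2)))"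
proof -
  have int: "integrable lborel std_normal_density"
    by (rule integrable_normal_density) simp
  have cos: "(LBINT \<eta>. cos (t * \<eta>) * std_normal_density \<eta>) = exp (- t\<^sup>2 / 2)" for t
  proof -
    have "complex_integrable lborel (\<lambda>\<eta>. std_normal_density \<eta> *\<^sub>R iexp (t * \<eta>))"
      by (rule Bochner_Integration.integrable_bound[OF int]) auto
    then have "(LBINT \<eta>. Re (std_normal_density \<eta> *\<^sub>R iexp (t * \<eta>)))
        = Re (CLBINT \<eta>. std_normal_density \<eta> *\<^sub>R iexp (t * \<eta>))"
      by (rule integral_Re)
    also have "\<dots> = Re (char std_normal_distribution t)"
      unfolding char_def by (subst integral_density) auto
    also have "\<dots> = exp (- t\<^sup>2 / 2)"
      by (simp add: char_std_normal_distribution del: of_real_exp)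
    finally show ?thesis
      by (simp add: Re_exp mult.commute del: of_real_mult)
  qed
  \<comment> \<open>This \<open>k\<close> satisfies \<open>c * k\<^sup>2 = 1 / 2\<close>, so that
    \<xi> = k \<eta> produces the standard normal exponent.\<close>
  define k where "k = 1 / sqrt (2 * c)"
  have k: "k > 0" "k\<^sup>2 = 1 / (2 * c)" using c by (auto simp: k_def power_divide)
  have scale: "exp (- (c * (k * \<eta>)\<^sup>2)) = sqrt (2 * pi) * std_normal_density \<eta>" for \<eta>
    using c by (simp add: std_normal_density_def power_mult_distrib k)
  have "(LBINT \<xi>. cos (x * \<xi>) * exp (- (c * \<xi>\<^sup>2)))
      = k * (LBINT \<eta>. cos (x * (k * \<eta>)) * exp (- (c * (k * \<eta>)\<^sup>2)))"
    using k by (subst lborel_integral_real_affine[where c = k and t = 0]) auto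
  also have "\<dots> = k * (LBINT \<eta>. sqrt (2 * pi) * (cos (x * k * \<eta>) * std_normal_density \<eta>))"
    unfolding scale by (simp add: mult_ac)
  also have "\<dots> = k * sqrt (2 * pi) * exp (- (x * k)\<^sup>2 / 2)"
    by (simp add: cos)
  also have "\<dots> = sqrt (pi / c) * exp (- (x\<^sup>2 / (4 * c)))"
    using c by (simp add: power_mult_distrib k) (simp add: k_def real_sqrt_mult real_sqrt_divide)
  finally show "(LBINT \<xi>. cos (x * \<xi>) * exp (- (c * \<xi>\<^sup>2))) = sqrt (pi / c) * exp (- (x\<^sup>2 / (4 * c)))" .
  have "integrable lborel (\<lambda>\<eta>. exp (- (c * (0 + k * \<eta>)\<^sup>2)))"
    unfolding add_0_left scale using int by simp
  then show "integrable lborel (\<lambda>\<xi>. exp (- (c * \<xi>\<^sup>2)))"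
    using k by (subst (asm) lborel_integrable_real_affine_iff[where f = "\<lambda>\<xi>. exp (- (c * \<xi>\<^sup>2))"]) auto
qed

lemma measurable_exp_mixture_square:
  assumes "exp_mixture u"
  shows "(\<lambda>\<xi>::real. u (\<xi>\<^sup>2)) \<in> borel_measurable borel"
  using assms
proof induction
  case (lim u B v)
  note [measurable] = lim(4)
  \<comment> \<open>Convergence is known only at positive arguments, so the value at \<xi> = 0 is
    frozen to \<open>v 0\<close> along the whole sequence.\<close>
  have "(\<lambda>\<xi>::real. if \<xi> = 0 then v 0 else v (\<xi>\<^sup>2)) \<in> borel_measurable borel"
  proof (rule borel_measurable_LIMSEQ_real)
    show "(\<lambda>i. if \<xi> = 0 then v 0 else u i (\<xi>\<^sup>2)) \<longlonglongrightarrow> (if \<xi> = 0 then v 0 else v (\<xi>\<^sup>2))" for \<xi> :: real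
      using lim(3)[of "\<xi>\<^sup>2"] by auto
  qed measurable
  also have "(\<lambda>\<xi>::real. if \<xi> = 0 then v 0 else v (\<xi>\<^sup>2)) = (\<lambda>\<xi>. v (\<xi>\<^sup>2))"
    by auto
  finally show ?case .
qed auto

text \<open>The damping factor with \<open>\<tau> > 0\<close> makes the integrand integrable for every mixture.\<close>

lemma exp_mixture_cos_transform:
  fixes \<tau> :: real
  assumes u: "exp_mixture u" and \<tau>: "0 < \<tau>"
  defines "J \<equiv> \<lambda>u x. LBINT \<xi>. cos (x * \<xi>) * (u (\<xi>\<^sup>2) * exp (- (\<tau> * \<xi>\<^sup>2)))"
  shows "0 \<le> J u x" and "\<bar>x\<bar> \<le> \<bar>y\<bar> \<Longrightarrow> J u y \<le> J u x"
proof -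
  \<comment> \<open>Mixtures are controlled only at positive arguments, and
    \<open>\<xi>\<^sup>2\<close> is positive off the null set \<xi> = 0.\<close>
  have AE0: "AE \<xi> in lborel. \<xi> \<noteq> (0::real)"
    by (rule AE_lborel_singleton)
  have integ: "integrable lborel (\<lambda>\<xi>. cos (x * \<xi>) * (u (\<xi>\<^sup>2) * exp (- (\<tau> * \<xi>\<^sup>2))))"
    if "exp_mixture u" for x u
  proof -
    note [measurable] = measurable_exp_mixture_square[OF that]
    obtain B where B: "\<And>r. 0 < r \<Longrightarrow> 0 \<le> u r" "\<And>r. 0 < r \<Longrightarrow> u r \<le> B"
      using exp_mixture_bounds[OF \<open>exp_mixture u\<close>] by metis
    show ?thesis
    proof (rule Bochner_Integration.integrable_bound)
      show "integrable lborel (\<lambda>\<xi>. B * exp (- (\<tau> * \<xi>\<^sup>2)))"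
        using gaussian_cos_transform(2)[OF \<tau>] by simp
      show "AE \<xi> in lborel. norm (cos (x * \<xi>) * (u (\<xi>\<^sup>2) * exp (- (\<tau> * \<xi>\<^sup>2)))) \<le> norm (B * exp (- (\<tau> * \<xi>\<^sup>2)))"
        using AE0
      proof eventually_elim
        case (elim \<xi>)
        then have "0 \<le> u (\<xi>\<^sup>2)" "u (\<xi>\<^sup>2) \<le> B" using B by auto
        then show ?case
          using mult_right_mono[of "u (\<xi>\<^sup>2)" B "exp (- (\<tau> * \<xi>\<^sup>2))"]
          by (simp only: real_norm_def) (rule order_trans[OF abs_cos_mult_le], simp)
      qed
    qed auto
  qed
  have "(\<forall>x. 0 \<le> J u x) \<and> (\<forall>x y. \<bar>x\<bar> \<le> \<bar>y\<bar> \<longrightarrow> J u y \<le> J u x)"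
    using u
  proof induction
    \<comment> \<open>The damping merely replaces \<open>s\<close> by \<open>s + \<tau>\<close>: the
      transform is a centred Gaussian, which is positive and decreasing in the modulus of
      \<open>x\<close>. Both properties survive nonnegative combinations and pointwise
      limits.\<close>
    case (exp s)
    have "J (\<lambda>r. exp (- (s * r))) x = sqrt (pi / (s + \<tau>)) * exp (- (x\<^sup>2 / (4 * (s + \<tau>))))" for x
      using gaussian_cos_transform(1)[of "s + \<tau>" x] exp \<tau>
      by (simp add: J_def distrib_right flip: exp_add)
    then show ?case
      using exp \<tau> by (auto intro!: mult_left_mono divide_right_mono simp flip: abs_le_square_iff)
  next
    case (lincomb u v a b)
    have "J (\<lambda>r. a * u r + b * v r) x = a * J u x + b * J v x" for x
    proof -
      have "(\<lambda>\<xi>. cos (x * \<xi>) * ((a * u (\<xi>\<^sup>2) + b * v (\<xi>\<^sup>2)) * exp (- (\<tau> * \<xi>\<^sup>2))))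
        = (\<lambda>\<xi>. a * (cos (x * \<xi>) * (u (\<xi>\<^sup>2) * exp (- (\<tau> * \<xi>\<^sup>2)))) + b * (cos (x * \<xi>) * (v (\<xi>\<^sup>2) * exp (- (\<tau> * \<xi>\<^sup>2)))))"
        by (auto simp: algebra_simps)
      then show ?thesis
        unfolding J_def using integ[OF lincomb(1)] integ[OF lincomb(2)]
        by (simp only:) (simp add: Bochner_Integration.integral_add)
    qed
    then show ?case
      using lincomb by (auto intro!: add_mono mult_left_mono)
  next
    case (lim u B v)
    have v: "exp_mixture v" by (rule exp_mixture.lim[OF lim(1-3)])
    note [measurable] = measurable_exp_mixture_square[OF v] measurable_exp_mixture_square[OF lim(1)]
    have "(\<lambda>n. J (u n) x) \<longlonglongrightarrow> J v x" for x
      unfolding J_def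
    proof (rule integral_dominated_convergence)
      show "integrable lborel (\<lambda>\<xi>. B * exp (- (\<tau> * \<xi>\<^sup>2)))"
        using gaussian_cos_transform(2)[OF \<tau>] by simp
      show "AE \<xi> in lborel. (\<lambda>n. cos (x * \<xi>) * (u n (\<xi>\<^sup>2) * exp (- (\<tau> * \<xi>\<^sup>2)))) \<longlonglongrightarrow> cos (x * \<xi>) * (v (\<xi>\<^sup>2) * exp (- (\<tau> * \<xi>\<^sup>2)))"
        using AE0 by eventually_elim (auto intro!: tendsto_intros lim(3))
      show "AE \<xi> in lborel. norm (cos (x * \<xi>) * (u n (\<xi>\<^sup>2) * exp (- (\<tau> * \<xi>\<^sup>2)))) \<le> B * exp (- (\<tau> * \<xi>\<^sup>2))" for n
        using AE0
      proof eventually_elim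
        case (elim \<xi>)
        then have "0 \<le> u n (\<xi>\<^sup>2)" "u n (\<xi>\<^sup>2) \<le> B"
          using exp_mixture_bounds[OF lim(1)[of n]] lim(2) by (metis zero_less_power2)+
        then show ?case
          by (simp only: real_norm_def) (rule order_trans[OF abs_cos_mult_le], simp)
      qed
    qed measurable
    note J_lim = this
    show ?case
      using lim(4) by (intro conjI allI impI LIMSEQ_le_const[OF J_lim] LIMSEQ_le[OF J_lim J_lim]) auto
  qed
  then show "0 \<le> J u x" and "\<bar>x\<bar> \<le> \<bar>y\<bar> \<Longrightarrow> J u y \<le> J u x"
    by auto
qed

section \<open>The inverse Fourier transform of the stretched exponential\<close>

text \<open>Comparison with \<open>inverse (1 + \<xi>\<^sup>2)\<close>: one term of the exponential
  series gives \<open>y ^ k \<le> fact k * exp y\<close>, applied to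
  \<open>y = \<bar>\<xi>\<bar> powr \<sigma>\<close> with \<open>k\<close> so large that
  \<open>y ^ k\<close> exceeds \<open>\<xi>\<^sup>2\<close> when the modulus of \<xi> is above
  1.\<close>

lemma integrable_exp_minus_abs_powr:
  fixes \<sigma> :: real
  assumes \<sigma>: "0 < \<sigma>"
  shows "integrable lborel (\<lambda>\<xi>. exp (- (\<bar>\<xi>\<bar> powr \<sigma>)))"
proof -
  obtain k :: nat where k: "2 / \<sigma> \<le> real k"
    using real_arch_simple by blast
  have bound: "exp (- (\<bar>\<xi>\<bar> powr \<sigma>)) \<le> 2 * fact k * inverse (1 + \<xi>\<^sup>2)" for \<xi> :: real
  proof (cases "\<bar>\<xi>\<bar> \<le> 1")
    case True
    then have "1 + \<xi>\<^sup>2 \<le> 2" by (simp add: abs_square_le_1)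
    moreover have "exp (- (\<bar>\<xi>\<bar> powr \<sigma>)) \<le> 1" "(1::real) \<le> fact k" by auto
    ultimately have "exp (- (\<bar>\<xi>\<bar> powr \<sigma>)) * (1 + \<xi>\<^sup>2) \<le> 1 * (2 * fact k)"
      by (intro mult_mono) (linarith | simp)+
    then show ?thesis
      by (simp add: field_simps add_pos_nonneg)
  next
    case False
    have "\<xi>\<^sup>2 = \<bar>\<xi>\<bar> powr 2" using False by (simp add: powr_numeral)
    also have "\<dots> \<le> \<bar>\<xi>\<bar> powr (\<sigma> * real k)"
      using False k \<sigma> by (intro powr_mono) (auto simp: field_simps)
    also have "\<dots> = (\<bar>\<xi>\<bar> powr \<sigma>) ^ k"
      using False by (simp add: powr_powr[symmetric] powr_realpow)
    also have "\<dots> \<le> fact k * exp (\<bar>\<xi>\<bar> powr \<sigma>)"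
    proof -
      have "(\<bar>\<xi>\<bar> powr \<sigma>) ^ k / fact k \<le> exp (\<bar>\<xi>\<bar> powr \<sigma>)"
        using sum_le_suminf[OF summable_exp, of "{k}" "\<bar>\<xi>\<bar> powr \<sigma>"]
        by (simp add: exp_def divide_inverse mult_ac)
      then show ?thesis by (simp add: field_simps)
    qed
    finally have 1: "\<xi>\<^sup>2 \<le> fact k * exp (\<bar>\<xi>\<bar> powr \<sigma>)" .
    have "1 \<le> \<xi>\<^sup>2" using False by (metis abs_square_le_1 linear not_le)
    with 1 have "1 + \<xi>\<^sup>2 \<le> 2 * fact k * exp (\<bar>\<xi>\<bar> powr \<sigma>)" by linarith
    then show ?thesis
      by (simp add: exp_minus field_simps add_pos_nonneg)
  qed
  show ?thesis
  proof (rule Bochner_Integration.integrable_bound)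
    show "integrable lborel (\<lambda>\<xi>::real. 2 * fact k * inverse (1 + \<xi>\<^sup>2))"
      using integrable_inverse_1_plus_square by (simp add: set_integrable_def)
    show "AE \<xi> in lborel. norm (exp (- (\<bar>\<xi>\<bar> powr \<sigma>))) \<le> norm (2 * fact k * inverse (1 + \<xi>\<^sup>2))"
      using bound by (intro always_eventually allI) (auto simp: abs_mult add_pos_nonneg)
  qed measurable
qed

text \<open>Fourier inversion of an even function leaves only the cosine. The formula singles out a
  continuous representative of the density, for which pointwise statements make sense.\<close>

definition stable_kernel :: "real \<Rightarrow> real \<Rightarrow> real" where
  "stable_kernel \<sigma> x = 1 / (2 * pi) * (LBINT \<xi>. cos (x * \<xi>) * exp (- (\<bar>\<xi>\<bar> powr \<sigma>)))"

text \<open>The function \<open>exp (- (r powr (\<sigma> / 2)))\<close> is a mixture, and at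
  \<open>r = \<xi>\<^sup>2\<close> it is the target transform. The damped transforms are nonnegative
  and decreasing in the modulus; letting the damping \<open>1 / Suc n\<close> tend to 0 keeps both
  properties.\<close>

lemma
  assumes \<sigma>: "0 < \<sigma>" "\<sigma> < 2"
  shows stable_kernel_nonneg: "0 \<le> stable_kernel \<sigma> x"
    and stable_kernel_antimono: "\<bar>x\<bar> \<le> \<bar>y\<bar> \<Longrightarrow> stable_kernel \<sigma> y \<le> stable_kernel \<sigma> x"
proof -
  define J where "J n x = (LBINT \<xi>. cos (x * \<xi>) * (exp (- (\<xi>\<^sup>2 powr (\<sigma> / 2))) * exp (- (1 / Suc n * \<xi>\<^sup>2))))"
    for n :: nat and x :: real
  have mix: "exp_mixture (\<lambda>r. exp (- (r powr (\<sigma> / 2))))"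
    using \<sigma> by (intro exp_mixture_exp_minus_powr) auto
  have pow: "\<xi>\<^sup>2 powr (\<sigma> / 2) = \<bar>\<xi>\<bar> powr \<sigma>" for \<xi> :: real
  proof (cases "\<xi> = 0")
    case False
    then have "\<xi>\<^sup>2 = \<bar>\<xi>\<bar> powr 2" by (simp add: powr_numeral)
    then have "\<xi>\<^sup>2 powr (\<sigma> / 2) = \<bar>\<xi>\<bar> powr (2 * (\<sigma> / 2))"
      by (simp only: powr_powr)
    then show ?thesis by simp
  qed simp
  have lim: "(\<lambda>n. J n x) \<longlonglongrightarrow> 2 * pi * stable_kernel \<sigma> x" for x
  proof -
    have "(\<lambda>n. J n x) \<longlonglongrightarrow> (LBINT \<xi>. cos (x * \<xi>) * exp (- (\<bar>\<xi>\<bar> powr \<sigma>)))"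
      unfolding J_def pow
    proof (rule integral_dominated_convergence[OF _ _ integrable_exp_minus_abs_powr[OF \<sigma>(1)]])
      show "AE \<xi> in lborel. (\<lambda>n. cos (x * \<xi>) * (exp (- (\<bar>\<xi>\<bar> powr \<sigma>)) * exp (- (1 / real (Suc n) * \<xi>\<^sup>2))))
          \<longlonglongrightarrow> cos (x * \<xi>) * exp (- (\<bar>\<xi>\<bar> powr \<sigma>))"
      proof (intro always_eventually allI)
        fix \<xi> :: real
        have "(\<lambda>n. exp (- (1 / real (Suc n) * \<xi>\<^sup>2))) \<longlonglongrightarrow> 1"
          by real_asymp
        from tendsto_mult[OF tendsto_const tendsto_mult[OF tendsto_const this]]
        show "(\<lambda>n. cos (x * \<xi>) * (exp (- (\<bar>\<xi>\<bar> powr \<sigma>)) * exp (- (1 / real (Suc n) * \<xi>\<^sup>2))))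
          \<longlonglongrightarrow> cos (x * \<xi>) * exp (- (\<bar>\<xi>\<bar> powr \<sigma>))"
          by (simp only: mult_1_right)
      qed
      show "AE \<xi> in lborel. norm (cos (x * \<xi>) * (exp (- (\<bar>\<xi>\<bar> powr \<sigma>)) * exp (- (1 / real (Suc n) * \<xi>\<^sup>2)))) \<le> exp (- (\<bar>\<xi>\<bar> powr \<sigma>))" for n
      proof (intro always_eventually allI)
        fix \<xi> :: real
        have "exp (- (1 / real (Suc n) * \<xi>\<^sup>2)) \<le> 1"
          by (simp del: of_nat_Suc)
        then show "norm (cos (x * \<xi>) * (exp (- (\<bar>\<xi>\<bar> powr \<sigma>)) * exp (- (1 / real (Suc n) * \<xi>\<^sup>2)))) \<le> exp (- (\<bar>\<xi>\<bar> powr \<sigma>))"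
          unfolding real_norm_def
          by (intro order_trans[OF abs_cos_mult_le]) (simp add: mult_left_le del: of_nat_Suc)
      qed
    qed measurable
    then show ?thesis by (simp add: stable_kernel_def)
  qed
  have "0 \<le> 2 * pi * stable_kernel \<sigma> x"
    by (rule LIMSEQ_le_const[OF lim], unfold J_def)
      (intro exI[of _ 0] allI impI exp_mixture_cos_transform(1)[OF mix], simp)
  then show "0 \<le> stable_kernel \<sigma> x"
    using pi_gt_zero by (simp add: zero_le_mult_iff)
  assume "\<bar>x\<bar> \<le> \<bar>y\<bar>"
  then have "2 * pi * stable_kernel \<sigma> y \<le> 2 * pi * stable_kernel \<sigma> x"
    by (intro LIMSEQ_le[OF lim lim], unfold J_def)
      (intro exI[of _ 0] allI impI exp_mixture_cos_transform(2)[OF mix], simp_all)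
  then show "stable_kernel \<sigma> y \<le> stable_kernel \<sigma> x"
    by simp
qed

lemma continuous_stable_kernel:
  assumes \<sigma>: "0 < \<sigma>"
  shows "continuous_on UNIV (stable_kernel \<sigma>)"
proof (rule continuous_at_imp_continuous_on, rule ballI)
  fix x :: real
  have "(\<lambda>n. LBINT \<xi>. cos (X n * \<xi>) * exp (- (\<bar>\<xi>\<bar> powr \<sigma>)))
      \<longlonglongrightarrow> (LBINT \<xi>. cos (x * \<xi>) * exp (- (\<bar>\<xi>\<bar> powr \<sigma>)))" if "X \<longlonglongrightarrow> x" for X
  proof (rule integral_dominated_convergence[OF _ _ integrable_exp_minus_abs_powr[OF \<sigma>]])
    show "AE \<xi> in lborel. (\<lambda>n. cos (X n * \<xi>) * exp (- (\<bar>\<xi>\<bar> powr \<sigma>))) \<longlonglongrightarrow> cos (x * \<xi>) * exp (- (\<bar>\<xi>\<bar> powr \<sigma>))"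
      by (intro always_eventually allI tendsto_intros that)
  qed (simp_all add: abs_mult)
  then show "isCont (stable_kernel \<sigma>) x"
    unfolding isCont_def tendsto_at_iff_sequentially stable_kernel_def comp_def
    by (intro allI impI tendsto_mult tendsto_const) blast
qed

subsection \<open>Fourier inversion\<close>

text \<open>Levy inversion yields the mass of bounded intervals, whereas the uniqueness criterion
  speaks of rays; continuity from below along \<open>{x<..x + real n}\<close> bridges the
  two.\<close>

lemma measure_eqI_greaterThanAtMost:
  fixes M N :: "real measure"
  assumes sets: "sets M = sets borel" "sets N = sets borel"
    and fin: "\<And>x. emeasure M {x<..} < \<infinity>"
    and eq: "\<And>a b. a \<le> b \<Longrightarrow> emeasure M {a<..b} = emeasure N {a<..b}"
  shows "M = N"
proof (rule measure_eqI_lessThan[OF sets fin])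
  fix x :: real
  have un: "(\<Union>n::nat. {x<..x + real n}) = {x<..}"
    by (auto, metis add.commute add_diff_cancel_left' diff_le_eq real_arch_simple)
  have inc: "incseq (\<lambda>n::nat. {x<..x + real n})"
    by (auto simp: incseq_def)
  have "emeasure M {x<..} = (SUP n::nat. emeasure M {x<..x + real n})"
    unfolding un[symmetric] using inc by (intro SUP_emeasure_incseq[symmetric]) (auto simp: sets)
  also have "\<dots> = (SUP n::nat. emeasure N {x<..x + real n})"
    by (simp add: eq)
  also have "\<dots> = emeasure N {x<..}"
    unfolding un[symmetric] using inc by (intro SUP_emeasure_incseq) (auto simp: sets)
  finally show "emeasure M {x<..} = emeasure N {x<..}" .
qed

text \<open>Fubini moves the integral over the interval onto the cosine. The outcome is the real
  form of the integral in Levy's inversion formula.\<close>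

lemma integral_stable_kernel_interval:
  assumes \<sigma>: "0 < \<sigma>" and "a \<le> b"
  shows "(LBINT x. indicator {a..b} x * stable_kernel \<sigma> x)
    = 1 / (2 * pi) * (LBINT \<xi>. (sin (b * \<xi>) - sin (a * \<xi>)) / \<xi> * exp (- (\<bar>\<xi>\<bar> powr \<sigma>)))"
proof -
  let ?f = "\<lambda>x \<xi>. indicator {a..b} x * (cos (x * \<xi>) * exp (- (\<bar>\<xi>\<bar> powr \<sigma>))) :: real"
  have ind: "integrable lborel (indicat_real {a..b})"
    using \<open>a \<le> b\<close> by (intro integrable_real_indicator) auto
  have "integrable (lborel \<Otimes>\<^sub>M lborel) (\<lambda>(x, \<xi>). indicator {a..b} x * exp (- (\<bar>\<xi>\<bar> powr \<sigma>)))"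
    using integrable_exp_minus_abs_powr[OF \<sigma>] ind
    by (intro lborel_pair.Fubini_integrable) (auto simp: abs_mult)
  then have int: "integrable (lborel \<Otimes>\<^sub>M lborel) (\<lambda>(x, \<xi>). ?f x \<xi>)"
    by (rule Bochner_Integration.integrable_bound) (auto simp: abs_mult indicator_def)
  have "(LBINT x. indicator {a..b} x * stable_kernel \<sigma> x) = (LBINT x. 1 / (2 * pi) * (LBINT \<xi>. ?f x \<xi>))"
    by (intro Bochner_Integration.integral_cong) (auto simp: stable_kernel_def)
  also have "\<dots> = 1 / (2 * pi) * (LBINT x. LBINT \<xi>. ?f x \<xi>)"
    by simp
  also have "(LBINT x. LBINT \<xi>. ?f x \<xi>) = (LBINT \<xi>. LBINT x. ?f x \<xi>)"
    using lborel_pair.Fubini_integral[OF int] by simp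
  also have "\<dots> = (LBINT \<xi>. (sin (b * \<xi>) - sin (a * \<xi>)) / \<xi> * exp (- (\<bar>\<xi>\<bar> powr \<sigma>)))"
  proof (rule integral_cong_AE)
    \<comment> \<open>At \<xi> = 0 the quotient is 0 by convention while the inner integral is
      \<open>b - a\<close>, so equality holds only almost everywhere.\<close>
    show "AE \<xi> in lborel. (LBINT x. ?f x \<xi>) = (sin (b * \<xi>) - sin (a * \<xi>)) / \<xi> * exp (- (\<bar>\<xi>\<bar> powr \<sigma>))"
      using AE_lborel_singleton[of 0]
    proof eventually_elim
      case (elim \<xi>)
      have "(LBINT x. cos (x * \<xi>) * indicator {a..b} x) = sin (b * \<xi>) / \<xi> - sin (a * \<xi>) / \<xi>"
        using elim \<open>a \<le> b\<close>
        by (intro integral_FTC_Icc_real) (auto intro!: derivative_eq_intros continuous_intros)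
      moreover have "(LBINT x. ?f x \<xi>) = (LBINT x. cos (x * \<xi>) * indicator {a..b} x) * exp (- (\<bar>\<xi>\<bar> powr \<sigma>))"
        by (subst integral_mult_left_zero[symmetric]) (simp add: mult_ac)
      ultimately show ?case
        by (simp add: diff_divide_distrib)
    qed
  qed measurable
  finally show ?thesis .
qed

text \<open>By Levy inversion the law with density \<open>g\<close> gives every interval the mass
  that \<open>stable_kernel\<close> gives it; equal measures have almost everywhere equal
  densities.\<close>

lemma stable_density_AE_eq_stable_kernel:
  assumes g: "stable_density \<sigma> g" and \<sigma>: "0 < \<sigma>" "\<sigma> < 2"
  shows "AE x in lborel. g x = stable_kernel \<sigma> x"
proof -
  define M where "M = density lborel (\<lambda>x. ennreal (g x))"
  have g_meas [measurable]: "g \<in> borel_measurable borel" and g_nn: "\<And>x. 0 \<le> g x"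
    and g_int: "integrable lborel g" and g_one: "(\<integral>x. g x \<partial>lborel) = 1"
    using g by (auto simp: stable_density_def)
  have k_meas [measurable]: "stable_kernel \<sigma> \<in> borel_measurable borel"
    using continuous_stable_kernel[OF \<sigma>(1)] by (rule borel_measurable_continuous_onI)
  interpret M: prob_space M
    by (rule prob_spaceI)
      (simp add: M_def emeasure_density nn_integral_eq_integral[OF g_int] g_nn g_one)
  interpret M: real_distribution M
    by unfold_locales (simp add: M_def)
  have char: "char M t = exp (- (\<bar>t\<bar> powr \<sigma>))" for t
  proof -
    have "char M t = (CLBINT x. g x *\<^sub>R iexp (t * x))"
      unfolding char_def M_def by (subst integral_density) (auto simp: g_nn)
    \<comment> \<open>The transform in \<open>stable_density\<close> carries the opposite sign
      convention, so it is evaluated at \<open>- t\<close>; the right-hand side is even.\<close>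
    also have "\<dots> = (CLBINT x. exp (- (\<i> * complex_of_real ((- t) * x))) * complex_of_real (g x))"
      by (simp add: scaleR_conv_of_real mult_ac)
    also have "\<dots> = complex_of_real (exp (- (\<bar>- t\<bar> powr \<sigma>)))"
      using g unfolding stable_density_def by blast
    finally show ?thesis by simp
  qed
  \<comment> \<open>Levy inversion requires endpoints without atoms.\<close>
  have sing: "measure M {a} = 0" for a
    unfolding M_def measure_def by (subst emeasure_density) (auto simp: nn_integral_indicator_singleton')
  let ?F = "\<lambda>a b t. (iexp (- (t * a)) - iexp (- (t * b))) / (\<i> * complex_of_real t) * complex_of_real (exp (- (\<bar>t\<bar> powr \<sigma>)))"
  have interval: "measure M {a<..b} = (LBINT x. indicator {a..b} x * stable_kernel \<sigma> x)" if "a \<le> b" for a b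
  proof -
    have F_bound: "AE t in lborel. norm (?F a b t) \<le> (b - a) * exp (- (\<bar>t\<bar> powr \<sigma>))"
      using AE_lborel_singleton[of 0]
    proof eventually_elim
      case (elim t)
      have "cmod ((iexp (- (t * a)) - iexp (- (t * b))) / (\<i> * complex_of_real t)) \<le> b - a"
        using Levy_Inversion_aux2[of "- b" "- a" t] \<open>a \<le> b\<close> elim by simp
      then show ?case
        using \<open>a \<le> b\<close> unfolding norm_mult by (intro mult_mono) auto
    qed
    have b_int: "integrable lborel (\<lambda>t. (b - a) * exp (- (\<bar>t\<bar> powr \<sigma>)))"
      using integrable_exp_minus_abs_powr[OF \<sigma>(1)] by simp
    have F_int: "complex_integrable lborel (?F a b)"
      using F_bound by (intro Bochner_Integration.integrable_bound[OF b_int]) (auto elim: eventually_mono)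
    \<comment> \<open>The inversion formula is a limit of integrals over (-T, T). Since the
      characteristic function is integrable, the integrand is too, and the limit is the integral
      over the whole line.\<close>
    have "(\<lambda>T::nat. CLBINT t. indicator {- real T<..<real T} t *\<^sub>R ?F a b t) \<longlonglongrightarrow> (CLBINT t. ?F a b t)"
    proof (rule integral_dominated_convergence[OF _ _ b_int])
      show "AE t in lborel. (\<lambda>T::nat. indicator {- real T<..<real T} t *\<^sub>R ?F a b t) \<longlonglongrightarrow> ?F a b t"
      proof (rule always_eventually, rule allI, rule tendsto_eventually)
        fix t :: real
        obtain n where "\<bar>t\<bar> < real n" using reals_Archimedean2 by blast
        then show "\<forall>\<^sub>F T in sequentially. indicator {- real T<..<real T} t *\<^sub>R ?F a b t = ?F a b t"
          by (intro eventually_sequentiallyI[of n]) (auto simp: indicator_def)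
      qed
      show "AE t in lborel. norm (indicator {- real T<..<real T} t *\<^sub>R ?F a b t) \<le> (b - a) * exp (- (\<bar>t\<bar> powr \<sigma>))" for T
        using F_bound by eventually_elim (use \<open>a \<le> b\<close> in \<open>auto simp: indicator_def\<close>)
    qed measurable
    then have "(\<lambda>T::nat. 1 / (2 * pi) * (CLBINT t. indicator {- real T<..<real T} t *\<^sub>R ?F a b t)) \<longlonglongrightarrow> 1 / (2 * pi) * (CLBINT t. ?F a b t)"
      by (intro tendsto_intros)
    moreover have "(\<lambda>T::nat. 1 / (2 * pi) * (CLBINT t. indicator {- real T<..<real T} t *\<^sub>R ?F a b t)) \<longlonglongrightarrow> measure M {a<..b}"
      using M.Levy_Inversion[OF \<open>a \<le> b\<close> sing sing]
      by (simp add: interval_lebesgue_integral_def set_lebesgue_integral_def char)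
    ultimately have "complex_of_real (measure M {a<..b}) = 1 / (2 * pi) * (CLBINT t. ?F a b t)"
      using LIMSEQ_unique by blast
    then have "measure M {a<..b} = Re (1 / (2 * pi) * (CLBINT t. ?F a b t))"
      by (metis Re_complex_of_real)
    also have "\<dots> = 1 / (2 * pi) * Re (CLBINT t. ?F a b t)"
      by simp
    also have "Re (CLBINT t. ?F a b t) = (LBINT t. Re (?F a b t))"
      using F_int by (rule integral_Re[symmetric])
    also have "\<dots> = (LBINT t. (sin (b * t) - sin (a * t)) / t * exp (- (\<bar>t\<bar> powr \<sigma>)))"
    proof (intro Bochner_Integration.integral_cong)
      \<comment> \<open>At \<open>t = 0\<close> both sides vanish because division by zero yields
        0.\<close>
      show "Re (?F a b t) = (sin (b * t) - sin (a * t)) / t * exp (- (\<bar>t\<bar> powr \<sigma>))" for t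
        by (cases "t = 0") (auto simp: Re_divide Im_exp Re_exp field_simps power2_eq_square)
    qed simp
    finally show ?thesis
      using integral_stable_kernel_interval[OF \<sigma>(1) \<open>a \<le> b\<close>] by simp
  qed
  have "M = density lborel (\<lambda>x. ennreal (stable_kernel \<sigma> x))"
  proof (rule measure_eqI_greaterThanAtMost)
    fix a b :: real assume "a \<le> b"
    have "integrable lborel (\<lambda>x. indicator {a..b} x *\<^sub>R stable_kernel \<sigma> x)"
      using continuous_stable_kernel[OF \<sigma>(1)]
      by (intro borel_integrable_compact) (auto intro: continuous_on_subset)
    then have "emeasure M {a<..b} = (\<integral>\<^sup>+x. ennreal (indicator {a..b} x * stable_kernel \<sigma> x) \<partial>lborel)"
      using stable_kernel_nonneg[OF \<sigma>]
      by (subst nn_integral_eq_integral) (auto simp: M.emeasure_eq_measure interval[OF \<open>a \<le> b\<close>])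
    also have "\<dots> = (\<integral>\<^sup>+x. ennreal (stable_kernel \<sigma> x) * indicator {a<..b} x \<partial>lborel)"
      using AE_lborel_singleton[of a]
      by (intro nn_integral_cong_AE) (auto elim!: eventually_mono simp: indicator_def)
    also have "\<dots> = emeasure (density lborel (\<lambda>x. ennreal (stable_kernel \<sigma> x))) {a<..b}"
      by (simp add: emeasure_density)
    finally show "emeasure M {a<..b} = emeasure (density lborel (\<lambda>x. ennreal (stable_kernel \<sigma> x))) {a<..b}" .
  qed (auto simp: M.emeasure_eq_measure)
  then have "AE x in lborel. ennreal (g x) = ennreal (stable_kernel \<sigma> x)"
    unfolding M_def by (intro sigma_finite_measure.density_unique[OF sigma_finite_lborel]) auto
  then show ?thesis
    by eventually_elim (use g_nn stable_kernel_nonneg[OF \<sigma>] in auto)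
qed

subsection \<open>The Hardy-Littlewood maximal function\<close>

text \<open>The centred maximal function on the line, where \<open>ball x r\<close> has length
  \<open>2 * r\<close>. Extended values accommodate infinite averages.\<close>

definition hl_maximal :: "(real \<Rightarrow> ennreal) \<Rightarrow> real \<Rightarrow> ennreal" where
  "hl_maximal f x = (SUP r\<in>{0<..}. ennreal (1 / (2 * r)) * (\<integral>\<^sup>+t\<in>ball x r. f t \<partial>lborel))"

lemma nn_integral_ball_le_hl_maximal:
  assumes "0 < r"
  shows "(\<integral>\<^sup>+t\<in>ball x r. f t \<partial>lborel) \<le> ennreal (2 * r) * hl_maximal f x"
proof -
  have "(\<integral>\<^sup>+t\<in>ball x r. f t \<partial>lborel)
      = ennreal (2 * r) * (ennreal (1 / (2 * r)) * (\<integral>\<^sup>+t\<in>ball x r. f t \<partial>lborel))"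
    using assms by (simp add: mult.assoc[symmetric] ennreal_mult[symmetric])
  also have "\<dots> \<le> ennreal (2 * r) * hl_maximal f x"
    unfolding hl_maximal_def using assms by (intro mult_left_mono SUP_upper) auto
  finally show ?thesis .
qed

lemma emeasure_lborel_ball_real: "0 \<le> r \<Longrightarrow> emeasure lborel (ball x r) = ennreal (2 * r)" for x r :: real
  by (simp add: ball_eq_greaterThanLessThan)

text \<open>Vitali covering: each point of the superlevel set is the centre of a ball carrying mass
  at least \<open>t\<close> times its length, and a disjoint subfamily covers the set after fivefold
  enlargement. The Borel superset \<open>W\<close> avoids a measurability claim about the superlevel
  set itself.\<close>

lemma hl_maximal_weak_type:
  assumes [measurable]: "f \<in> borel_measurable borel"
    and fin: "(\<integral>\<^sup>+x. f x \<partial>lborel) < \<infinity>" and t: "0 < t"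
  obtains W where "W \<in> sets borel" "{x. ennreal t < hl_maximal f x} \<subseteq> W"
    "emeasure lborel W \<le> ennreal (5 / t) * (\<integral>\<^sup>+x. f x \<partial>lborel)"
proof -
  define A where "A = {x. ennreal t < hl_maximal f x}"
  define \<nu> where "\<nu> = density lborel f"
  have \<nu>_ball: "emeasure \<nu> (ball x r) = (\<integral>\<^sup>+t\<in>ball x r. f t \<partial>lborel)" for x r
    by (simp add: \<nu>_def emeasure_density)
  have \<nu>_le: "emeasure \<nu> S \<le> (\<integral>\<^sup>+x. f x \<partial>lborel)" for S
  proof -
    have "emeasure \<nu> S \<le> emeasure \<nu> (space \<nu>)" by (rule emeasure_space)
    then show ?thesis by (simp add: \<nu>_def emeasure_density)
  qed
  have "\<exists>r>0. ennreal (2 * r * t) \<le> emeasure \<nu> (ball x r)" if x: "x \<in> A" for x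
  proof -
    obtain r where r: "0 < r" "ennreal t < ennreal (1 / (2 * r)) * emeasure \<nu> (ball x r)"
      using x unfolding A_def hl_maximal_def \<nu>_ball by (auto simp: less_SUP_iff)
    have "ennreal (2 * r * t) = ennreal (2 * r) * ennreal t"
      using r t by (simp add: ennreal_mult)
    also have "\<dots> \<le> ennreal (2 * r) * (ennreal (1 / (2 * r)) * emeasure \<nu> (ball x r))"
      using r by (intro mult_left_mono) auto
    also have "\<dots> = emeasure \<nu> (ball x r)"
      using r by (simp add: mult.assoc[symmetric] ennreal_mult[symmetric])
    finally show ?thesis using r by blast
  qed
  then obtain \<rho> where \<rho>: "\<And>x. x \<in> A \<Longrightarrow> 0 < \<rho> x"
      "\<And>x. x \<in> A \<Longrightarrow> ennreal (2 * \<rho> x * t) \<le> emeasure \<nu> (ball x (\<rho> x))"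
    by metis
  obtain B where B: "(\<integral>\<^sup>+x. f x \<partial>lborel) = ennreal B" "0 \<le> B"
    using fin by (cases "\<integral>\<^sup>+x. f x \<partial>lborel") auto
  \<comment> \<open>The covering lemma wants bounded radii; the finite total mass \<open>B\<close>
    caps them.\<close>
  have bound: "\<rho> x \<le> B / (2 * t)" if "x \<in> A" for x
  proof -
    have "ennreal (2 * \<rho> x * t) \<le> ennreal B"
      using order_trans[OF \<rho>(2)[OF that] \<nu>_le] B by simp
    then show ?thesis
      using B t by (simp add: field_simps)
  qed
  have cover: "A \<subseteq> (\<Union>x\<in>A. ball x (\<rho> x))"
    using \<rho>(1) by auto
  obtain C where C: "countable C" "C \<subseteq> A"
      "pairwise (\<lambda>x y. disjnt (ball x (\<rho> x)) (ball y (\<rho> y))) C"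
      "A \<subseteq> (\<Union>x\<in>C. ball x (5 * \<rho> x))"
    by (rule Vitali_covering_lemma_balls[OF cover, of "B / (2 * t)"]) (use \<rho>(1) bound in blast)+
  define W where "W = (\<Union>x\<in>C. ball x (5 * \<rho> x))"
  have W [measurable]: "W \<in> sets borel"
    unfolding W_def using C(1) by (intro sets.countable_UN'') auto
  have "emeasure lborel W = (\<integral>\<^sup>+y. indicator W y \<partial>lborel)"
    by simp
  \<comment> \<open>Countable subadditivity, written as an exchange of integrals with the counting
    measure on \<open>C\<close>.\<close>
  also have "\<dots> \<le> (\<integral>\<^sup>+y. \<integral>\<^sup>+x. indicator (ball x (5 * \<rho> x)) y \<partial>count_space C \<partial>lborel)"
  proof (rule nn_integral_mono)
    fix y
    show "indicator W y \<le> (\<integral>\<^sup>+x. indicator (ball x (5 * \<rho> x)) y \<partial>count_space C)"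
    proof (cases "y \<in> W")
      case True
      then obtain x where "x \<in> C" "y \<in> ball x (5 * \<rho> x)" by (auto simp: W_def)
      then show ?thesis
        using nn_integral_ge_point[of x C "\<lambda>x. indicator (ball x (5 * \<rho> x)) y"] True by simp
    qed simp
  qed
  also have "\<dots> = (\<integral>\<^sup>+x. emeasure lborel (ball x (5 * \<rho> x)) \<partial>count_space C)"
    using C(1) by (subst nn_integral_count_space_nn_integral) (auto intro!: borel_measurable_indicator)
  also have "\<dots> \<le> (\<integral>\<^sup>+x. ennreal (5 / t) * emeasure \<nu> (ball x (\<rho> x)) \<partial>count_space C)"
  proof (rule nn_integral_mono)
    fix x assume "x \<in> space (count_space C)"
    with C(2) have x: "x \<in> A" by auto
    have "emeasure lborel (ball x (5 * \<rho> x)) = ennreal (5 / t) * ennreal (2 * \<rho> x * t)"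
      using \<rho>(1)[OF x] t by (subst emeasure_lborel_ball_real) (auto simp: ennreal_mult[symmetric])
    also have "\<dots> \<le> ennreal (5 / t) * emeasure \<nu> (ball x (\<rho> x))"
      by (intro mult_left_mono \<rho>(2)[OF x]) simp
    finally show "emeasure lborel (ball x (5 * \<rho> x)) \<le> ennreal (5 / t) * emeasure \<nu> (ball x (\<rho> x))" .
  qed
  also have "\<dots> = ennreal (5 / t) * (\<integral>\<^sup>+x. emeasure \<nu> (ball x (\<rho> x)) \<partial>count_space C)"
    by (rule nn_integral_cmult) simp
  also have "(\<integral>\<^sup>+x. emeasure \<nu> (ball x (\<rho> x)) \<partial>count_space C) = emeasure \<nu> (\<Union>x\<in>C. ball x (\<rho> x))"
    using C by (intro emeasure_UN_countable[symmetric])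
      (auto simp: \<nu>_def disjoint_family_on_def pairwise_def disjnt_def)
  also have "ennreal (5 / t) * \<dots> \<le> ennreal (5 / t) * (\<integral>\<^sup>+x. f x \<partial>lborel)"
    by (intro mult_left_mono \<nu>_le) simp
  finally show ?thesis
    using that[of W] C(4) by (simp add: A_def W_def[symmetric])
qed

text \<open>Pointwise \<open>f\<close> is at most its part above height \<open>c\<close> plus the
  constant \<open>c\<close>, and the average of a constant is that constant.\<close>

lemma hl_maximal_truncate:
  assumes [measurable]: "f \<in> borel_measurable borel"
  shows "hl_maximal f x \<le> hl_maximal (\<lambda>t. f t * indicator {t. c < f t} t) x + c"
  unfolding hl_maximal_def[of f]
proof (rule SUP_least)
  fix r :: real assume "r \<in> {0<..}"
  then have r: "0 < r" by simp
  let ?g = "\<lambda>t. f t * indicator {t. c < f t} t"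
  have [measurable]: "{t. c < f t} \<in> sets borel" "ball x r \<in> sets borel"
    by measurable
  have "(\<integral>\<^sup>+t\<in>ball x r. f t \<partial>lborel) \<le> (\<integral>\<^sup>+t. ?g t * indicator (ball x r) t + c * indicator (ball x r) t \<partial>lborel)"
    by (intro nn_integral_mono) (auto simp: indicator_def not_less)
  also have "\<dots> = (\<integral>\<^sup>+t\<in>ball x r. ?g t \<partial>lborel) + c * ennreal (2 * r)"
    using r by (subst nn_integral_add) (auto simp: nn_integral_cmult_indicator emeasure_lborel_ball_real)
  finally have "ennreal (1 / (2 * r)) * (\<integral>\<^sup>+t\<in>ball x r. f t \<partial>lborel)
      \<le> ennreal (1 / (2 * r)) * ((\<integral>\<^sup>+t\<in>ball x r. ?g t \<partial>lborel) + c * ennreal (2 * r))"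
    by (intro mult_left_mono) auto
  also have "\<dots> = ennreal (1 / (2 * r)) * (\<integral>\<^sup>+t\<in>ball x r. ?g t \<partial>lborel) + c * (ennreal (1 / (2 * r)) * ennreal (2 * r))"
    by (simp add: distrib_left mult_ac)
  also have "\<dots> = ennreal (1 / (2 * r)) * (\<integral>\<^sup>+t\<in>ball x r. ?g t \<partial>lborel) + c"
    using r by (subst ennreal_mult[symmetric]) auto
  also have "\<dots> \<le> hl_maximal ?g x + c"
    unfolding hl_maximal_def using r by (intro add_right_mono SUP_upper) auto
  finally show "ennreal (1 / (2 * r)) * (\<integral>\<^sup>+t\<in>ball x r. f t \<partial>lborel) \<le> hl_maximal ?g x + c" .
qed

section \<open>Domination of convolutions by the maximal function\<close>

text \<open>Layer-cake argument: each superlevel set of \<open>k\<close> at a positive height is, up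
  to endpoints, a ball around 0, so integrating \<open>f\<close> over its reflected translate costs
  at most its length times the maximal function. Integrating the lengths over all heights returns
  the integral of \<open>k\<close>.\<close>

lemma radially_decreasing_conv_le_hl_maximal:
  fixes k :: "real \<Rightarrow> real"
  assumes [measurable]: "k \<in> borel_measurable borel" "f \<in> borel_measurable borel"
    and decr: "\<And>x y. \<bar>x\<bar> \<le> \<bar>y\<bar> \<Longrightarrow> k y \<le> k x"
    and fin: "(\<integral>\<^sup>+z. ennreal (k z) \<partial>lborel) < \<infinity>"
  shows "(\<integral>\<^sup>+t. ennreal (k (x - t)) * f t \<partial>lborel) \<le> (\<integral>\<^sup>+z. ennreal (k z) \<partial>lborel) * hl_maximal f x"
proof -
  have level: "(\<integral>\<^sup>+t. f t * indicator {z. s < k z} (x - t) \<partial>lborel) \<le> hl_maximal f x * emeasure lborel {z. s < k z}"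
    if s: "0 < s" for s
  proof -
    define S where "S = {z. s < k z}"
    have [measurable]: "S \<in> sets borel" unfolding S_def by measurable
    have "ennreal s * emeasure lborel S = (\<integral>\<^sup>+z. ennreal s * indicator S z \<partial>lborel)"
      by (simp add: nn_integral_cmult_indicator)
    also have "\<dots> \<le> (\<integral>\<^sup>+z. ennreal (k z) \<partial>lborel)"
      by (intro nn_integral_mono) (auto simp: S_def indicator_def ennreal_leI)
    finally have "ennreal s * emeasure lborel S < \<infinity>"
      using fin by (rule order.strict_trans1)
    then have "emeasure lborel S < \<infinity>"
      using s by (auto simp: ennreal_mult_less_top)
    then obtain m where m: "emeasure lborel S = ennreal m" "0 \<le> m"
      by (cases "emeasure lborel S") auto
    \<comment> \<open>With \<open>z\<close> the set \<open>S\<close> contains the whole symmetric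
      interval up to \<open>z\<close>, whose length \<open>2 * \<bar>z\<bar>\<close> cannot exceed
      the measure \<open>m\<close> of \<open>S\<close>.\<close>
    have S_sub: "\<bar>z\<bar> \<le> m / 2" if "z \<in> S" for z
    proof -
      have "{- \<bar>z\<bar>..\<bar>z\<bar>} \<subseteq> S"
      proof
        fix w assume "w \<in> {- \<bar>z\<bar>..\<bar>z\<bar>}"
        then have "k z \<le> k w" by (intro decr) auto
        with that show "w \<in> S" by (simp add: S_def)
      qed
      then have "emeasure lborel {- \<bar>z\<bar>..\<bar>z\<bar>} \<le> emeasure lborel S"
        by (intro emeasure_mono) auto
      then show ?thesis using m by simp
    qed
    \<comment> \<open>\<open>S\<close> may contain its endpoints while the ball is open; the two
      resulting values of \<open>t\<close> form a null set.\<close>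
    have null: "AE t in lborel. t \<noteq> x - m / 2" "AE t in lborel. t \<noteq> x + m / 2"
      by (rule AE_lborel_singleton)+
    have "(\<integral>\<^sup>+t. f t * indicator S (x - t) \<partial>lborel) \<le> (\<integral>\<^sup>+t\<in>ball x (m / 2). f t \<partial>lborel)"
    proof (rule nn_integral_mono_AE, use null in eventually_elim)
      case (elim t)
      have "t \<in> ball x (m / 2)" if "x - t \<in> S"
        using S_sub[OF that] elim by (auto simp: dist_real_def abs_if split: if_splits)
      then show ?case by (auto simp: indicator_def)
    qed
    also have "\<dots> \<le> hl_maximal f x * emeasure lborel S"
    proof (cases "m = 0")
      case False
      then show ?thesis
        using nn_integral_ball_le_hl_maximal[of "m / 2" f x] m by (simp add: mult.commute)
    qed simp
    finally show ?thesis by (simp add: S_def)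
  qed
  have layer: "ennreal (k z) = (\<integral>\<^sup>+s. indicator {0<..} s * indicator {z. s < k z} z \<partial>lborel)" for z
  proof (cases "0 < k z")
    case True
    have "(\<integral>\<^sup>+s. indicator {0<..} s * indicator {z. s < k z} z \<partial>lborel) = (\<integral>\<^sup>+s. indicator {0<..<k z} s \<partial>lborel)"
      by (intro nn_integral_cong) (auto simp: indicator_def)
    then show ?thesis using True by simp
  next
    case False
    have "(\<integral>\<^sup>+s. indicator {0<..} s * indicator {z. s < k z} z \<partial>lborel) = (\<integral>\<^sup>+s. 0 \<partial>(lborel :: real measure))"
      using False by (intro nn_integral_cong) (auto simp: indicator_def)
    then show ?thesis using False by (simp add: ennreal_neg)
  qed
  have "(\<integral>\<^sup>+t. ennreal (k (x - t)) * f t \<partial>lborel)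
      = (\<integral>\<^sup>+t. \<integral>\<^sup>+s. indicator {0<..} s * (f t * indicator {z. s < k z} (x - t)) \<partial>lborel \<partial>lborel)"
    by (subst layer, subst nn_integral_multc[symmetric]) (auto simp: mult_ac)
  also have "\<dots> = (\<integral>\<^sup>+s. \<integral>\<^sup>+t. indicator {0<..} s * (f t * indicator {z. s < k z} (x - t)) \<partial>lborel \<partial>lborel)"
    by (rule lborel_pair.Fubini') measurable
  also have "\<dots> \<le> (\<integral>\<^sup>+s. indicator {0<..} s * (hl_maximal f x * emeasure lborel {z. s < k z}) \<partial>lborel)"
    using level by (intro nn_integral_mono) (auto simp: indicator_def nn_integral_cmult)
  also have "\<dots> = (\<integral>\<^sup>+s. hl_maximal f x * (\<integral>\<^sup>+z. indicator {0<..} s * indicator {z. s < k z} z \<partial>lborel) \<partial>lborel)"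
    by (intro nn_integral_cong) (subst nn_integral_cmult, auto simp: mult_ac)
  also have "\<dots> = hl_maximal f x * (\<integral>\<^sup>+s. \<integral>\<^sup>+z. indicator {0<..} s * indicator {z. s < k z} z \<partial>lborel \<partial>lborel)"
    by (rule nn_integral_cmult) measurable
  also have "(\<integral>\<^sup>+s. \<integral>\<^sup>+z. indicator {0<..} s * indicator {z. s < k z} z \<partial>lborel \<partial>lborel) = (\<integral>\<^sup>+z. ennreal (k z) \<partial>lborel)"
    by (subst layer, rule lborel_pair.Fubini') measurable
  finally show ?thesis by (simp add: mult.commute)
qed

section \<open>The strong type estimate by Marcinkiewicz interpolation\<close>

text \<open>Used twice: with \<open>q = p\<close> to express a p-th power by its levels, and with
  \<open>q = p - 1\<close> for the inner integral after the exchange of order.\<close>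

lemma nn_integral_powr_Ioo:
  assumes q: "0 < q" and a: "0 \<le> a"
  shows "(\<integral>\<^sup>+s. ennreal (q * s powr (q - 1)) * indicator {0<..<a} s \<partial>lborel) = ennreal (a powr q)"
proof -
  have "((\<lambda>s. q * s powr (q - 1)) has_integral q * (a powr q / q)) {0..a}"
    using has_integral_powr_from_0[of "q - 1" a] q a by (intro has_integral_mult_right) auto
  then have "(\<integral>\<^sup>+s. ennreal (q * s powr (q - 1)) * indicator {0..a} s \<partial>lborel) = ennreal (a powr q)"
    using q by (subst nn_integral_has_integral_lebesgue') auto
  moreover have "(\<integral>\<^sup>+s. ennreal (q * s powr (q - 1)) * indicator {0<..<a} s \<partial>lborel)
      = (\<integral>\<^sup>+s. ennreal (q * s powr (q - 1)) * indicator {0..a} s \<partial>lborel)"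
  proof (rule nn_integral_cong_AE)
    show "AE s in lborel. ennreal (q * s powr (q - 1)) * indicator {0<..<a} s = ennreal (q * s powr (q - 1)) * indicator {0..a} s"
      using AE_lborel_singleton[of 0] AE_lborel_singleton[of a]
      by eventually_elim (auto simp: indicator_def)
  qed
  ultimately show ?thesis by simp
qed

text \<open>Marcinkiewicz's splitting: only the part of \<open>f\<close> above height \<open>s / 2\<close> contributes at level \<open>s\<close>.\<close>

lemma emeasure_superlevel_le_of_le_hl_maximal:
  fixes f :: "real \<Rightarrow> real"
  assumes [measurable]: "f \<in> borel_measurable borel"
    and le: "\<And>x. F x \<le> hl_maximal (\<lambda>x. ennreal \<bar>f x\<bar>) x"
    and p: "1 \<le> p" and int: "integrable lborel (\<lambda>x. \<bar>f x\<bar> powr p)" and s: "0 < s"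
  shows "emeasure lborel {x. ennreal s < F x}
    \<le> ennreal (10 / s) * (\<integral>\<^sup>+x. ennreal \<bar>f x\<bar> * indicator {x. s < 2 * \<bar>f x\<bar>} x \<partial>lborel)"
proof -
  let ?f = "\<lambda>x. ennreal \<bar>f x\<bar>"
  let ?g = "\<lambda>t. ?f t * indicator {t. ennreal (s / 2) < ?f t} t"
  have g_eq: "?g = (\<lambda>x. ?f x * indicator {x. s < 2 * \<bar>f x\<bar>} x)"
    using s by (auto simp: fun_eq_iff indicator_def ennreal_less_iff)
  have "(\<integral>\<^sup>+x. ?g x \<partial>lborel) \<le> (\<integral>\<^sup>+x. ennreal ((s / 2) powr (1 - p) * \<bar>f x\<bar> powr p) \<partial>lborel)"
  proof (rule nn_integral_mono)
    fix x
    show "?g x \<le> ennreal ((s / 2) powr (1 - p) * \<bar>f x\<bar> powr p)"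
    proof (cases "s / 2 < \<bar>f x\<bar>")
      case True
      \<comment> \<open>Above height \<open>s / 2\<close> the nonpositive power \<open>1 - p\<close>
        is largest at \<open>s / 2\<close>. Hence the upper part of \<open>f\<close> is integrable
        and the weak type bound applies to it.\<close>
      have "\<bar>f x\<bar> = \<bar>f x\<bar> powr (1 - p) * \<bar>f x\<bar> powr p"
        using True s by (simp flip: powr_add)
      also have "\<dots> \<le> (s / 2) powr (1 - p) * \<bar>f x\<bar> powr p"
        using True s p by (intro mult_right_mono powr_mono2') auto
      finally show ?thesis
        by (auto simp: indicator_def intro: ennreal_leI)
    qed (use s in \<open>auto simp: indicator_def ennreal_less_iff\<close>)
  qed
  also have "\<dots> < \<infinity>"
    using int by (subst nn_integral_eq_integral) auto
  finally have fin: "(\<integral>\<^sup>+x. ?g x \<partial>lborel) < \<infinity>" .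
  obtain W where W: "W \<in> sets borel" "{x. ennreal (s / 2) < hl_maximal ?g x} \<subseteq> W"
      "emeasure lborel W \<le> ennreal (5 / (s / 2)) * (\<integral>\<^sup>+x. ?g x \<partial>lborel)"
    using hl_maximal_weak_type[OF _ fin, of "s / 2"] s by (auto simp: g_eq)
  have "{x. ennreal s < F x} \<subseteq> W"
  proof
    fix x assume "x \<in> {x. ennreal s < F x}"
    then have "ennreal s < hl_maximal ?f x"
      using le[of x] by (auto intro: less_le_trans)
    also have "\<dots> \<le> hl_maximal ?g x + ennreal (s / 2)"
      by (rule hl_maximal_truncate) measurable
    finally have "ennreal (s / 2) + ennreal (s / 2) < hl_maximal ?g x + ennreal (s / 2)"
      using s by (simp flip: ennreal_plus)
    then have "ennreal (s / 2) < hl_maximal ?g x"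
      by (metis add_right_mono not_le)
    then show "x \<in> W" using W(2) by auto
  qed
  then have "emeasure lborel {x. ennreal s < F x} \<le> emeasure lborel W"
    using W(1) by (intro emeasure_mono) auto
  with W(3) show ?thesis
    unfolding g_eq by (auto intro: order_trans)
qed

text \<open>The superlevel estimate is integrated against \<open>p * s powr (p - 1)\<close> and the
  order of integration exchanged. For fixed \<open>x\<close> the levels run up to
  \<open>2 * \<bar>f x\<bar>\<close>, and the weight \<open>s powr (p - 2)\<close> is integrable at
  0 because \<open>p > 1\<close>; this yields the factors \<open>10 * p / (p - 1)\<close> and
  \<open>2 powr (p - 1)\<close>.\<close>

lemma strong_type_of_le_hl_maximal:
  fixes f :: "real \<Rightarrow> real" and F :: "real \<Rightarrow> ennreal"
  assumes [measurable]: "f \<in> borel_measurable borel" "F \<in> borel_measurable borel"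
    and le: "\<And>x. F x \<le> hl_maximal (\<lambda>x. ennreal \<bar>f x\<bar>) x"
    and p: "1 < p" and int: "integrable lborel (\<lambda>x. \<bar>f x\<bar> powr p)"
  shows "AE x in lborel. F x < top"
    and "(\<integral>\<^sup>+x. ennreal (enn2real (F x) powr p) \<partial>lborel)
      \<le> ennreal (10 * p / (p - 1) * 2 powr (p - 1) * (\<integral>x. \<bar>f x\<bar> powr p \<partial>lborel))"
proof -
  define c where "c s = ennreal (p * s powr (p - 1)) * indicator {0<..} s" for s :: real
  have [measurable]: "c \<in> borel_measurable borel" unfolding c_def by measurable
  \<comment> \<open>\<open>H\<close> is the layer-cake form of the p-th power of \<open>F\<close>,
    with infinite value wherever \<open>F\<close> is infinite.\<close>
  define H where "H x = (\<integral>\<^sup>+s. c s * indicator {x. ennreal s < F x} x \<partial>lborel)" for x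
  have [measurable]: "H \<in> borel_measurable borel" unfolding H_def by measurable
  have H_ge: "ennreal (a powr p) \<le> H x" if "ennreal a \<le> F x" "0 \<le> a" for a x
  proof -
    have "ennreal (a powr p) = (\<integral>\<^sup>+s. ennreal (p * s powr (p - 1)) * indicator {0<..<a} s \<partial>lborel)"
      using p that by (intro nn_integral_powr_Ioo[symmetric]) auto
    also have "\<dots> \<le> H x"
      unfolding H_def
    proof (rule nn_integral_mono)
      fix s
      have "ennreal s < F x" if "0 < s" "s < a"
        using that \<open>ennreal a \<le> F x\<close> by (metis ennreal_lessI less_le_trans order_less_trans)
      then show "ennreal (p * s powr (p - 1)) * indicator {0<..<a} s \<le> c s * indicator {x. ennreal s < F x} x"
        by (auto simp: c_def indicator_def)
    qed
    finally show ?thesis .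
  qed
  have inner: "(\<integral>\<^sup>+s. ennreal (10 * p * s powr (p - 2)) * indicator {0<..<2 * \<bar>f x\<bar>} s \<partial>lborel)
      = ennreal (10 * p / (p - 1) * (2 * \<bar>f x\<bar>) powr (p - 1))" for x
  proof -
    have "(\<integral>\<^sup>+s. ennreal (10 * p * s powr (p - 2)) * indicator {0<..<2 * \<bar>f x\<bar>} s \<partial>lborel)
        = (\<integral>\<^sup>+s. ennreal (10 * p / (p - 1)) * (ennreal ((p - 1) * s powr (p - 1 - 1)) * indicator {0<..<2 * \<bar>f x\<bar>} s) \<partial>lborel)"
      using p by (intro nn_integral_cong) (auto simp: indicator_def ennreal_mult[symmetric])
    also have "\<dots> = ennreal (10 * p / (p - 1)) * ennreal ((2 * \<bar>f x\<bar>) powr (p - 1))"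
      using p by (subst nn_integral_cmult, measurable, subst nn_integral_powr_Ioo) auto
    also have "\<dots> = ennreal (10 * p / (p - 1) * (2 * \<bar>f x\<bar>) powr (p - 1))"
      using p by (intro ennreal_mult[symmetric]) auto
    finally show ?thesis .
  qed
  have "(\<integral>\<^sup>+x. H x \<partial>lborel) = (\<integral>\<^sup>+s. \<integral>\<^sup>+x. c s * indicator {x. ennreal s < F x} x \<partial>lborel \<partial>lborel)"
    unfolding H_def by (rule lborel_pair.Fubini') measurable
  also have "\<dots> = (\<integral>\<^sup>+s. c s * emeasure lborel {x. ennreal s < F x} \<partial>lborel)"
    by (intro nn_integral_cong nn_integral_cmult_indicator) measurable
  also have "\<dots> \<le> (\<integral>\<^sup>+s. c s * (ennreal (10 / s) * (\<integral>\<^sup>+x. ennreal \<bar>f x\<bar> * indicator {x. s < 2 * \<bar>f x\<bar>} x \<partial>lborel)) \<partial>lborel)"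
    using emeasure_superlevel_le_of_le_hl_maximal[OF assms(1) le _ int] p
    by (intro nn_integral_mono) (auto simp: c_def indicator_def intro!: mult_left_mono)
  also have "\<dots> = (\<integral>\<^sup>+s. \<integral>\<^sup>+x. ennreal \<bar>f x\<bar> * (ennreal (10 * p * s powr (p - 2)) * indicator {0<..<2 * \<bar>f x\<bar>} s) \<partial>lborel \<partial>lborel)"
  proof (rule nn_integral_cong)
    fix s :: real
    have "c s * ennreal (10 / s) = ennreal (10 * p * s powr (p - 2)) * indicator {0<..} s"
    proof (cases "0 < s")
      case True
      then have "s powr (p - 2) = s powr (p - 1) / s"
        using powr_diff[of s "p - 1" 1] by simp
      then have "p * s powr (p - 1) * (10 / s) = 10 * p * s powr (p - 2)" by simp
      with True p show ?thesis by (simp add: c_def ennreal_mult[symmetric])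
    qed (simp add: c_def)
    then have "c s * (ennreal (10 / s) * (\<integral>\<^sup>+x. ennreal \<bar>f x\<bar> * indicator {x. s < 2 * \<bar>f x\<bar>} x \<partial>lborel))
      = (ennreal (10 * p * s powr (p - 2)) * indicator {0<..} s) * (\<integral>\<^sup>+x. ennreal \<bar>f x\<bar> * indicator {x. s < 2 * \<bar>f x\<bar>} x \<partial>lborel)"
      by (simp only: mult.assoc[symmetric])
    also have "\<dots> = (\<integral>\<^sup>+x. (ennreal (10 * p * s powr (p - 2)) * indicator {0<..} s) * (ennreal \<bar>f x\<bar> * indicator {x. s < 2 * \<bar>f x\<bar>} x) \<partial>lborel)"
      by (rule nn_integral_cmult[symmetric]) measurable
    also have "\<dots> = (\<integral>\<^sup>+x. ennreal \<bar>f x\<bar> * (ennreal (10 * p * s powr (p - 2)) * indicator {0<..<2 * \<bar>f x\<bar>} s) \<partial>lborel)"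
      by (intro nn_integral_cong) (auto simp: indicator_def mult_ac)
    finally show "c s * (ennreal (10 / s) * (\<integral>\<^sup>+x. ennreal \<bar>f x\<bar> * indicator {x. s < 2 * \<bar>f x\<bar>} x \<partial>lborel))
      = (\<integral>\<^sup>+x. ennreal \<bar>f x\<bar> * (ennreal (10 * p * s powr (p - 2)) * indicator {0<..<2 * \<bar>f x\<bar>} s) \<partial>lborel)" .
  qed
  also have "\<dots> = (\<integral>\<^sup>+x. \<integral>\<^sup>+s. ennreal \<bar>f x\<bar> * (ennreal (10 * p * s powr (p - 2)) * indicator {0<..<2 * \<bar>f x\<bar>} s) \<partial>lborel \<partial>lborel)"
    by (rule lborel_pair.Fubini', measurable, simp only: greaterThanLessThan_iff, measurable)
  also have "\<dots> = (\<integral>\<^sup>+x. ennreal \<bar>f x\<bar> * ennreal (10 * p / (p - 1) * (2 * \<bar>f x\<bar>) powr (p - 1)) \<partial>lborel)"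
    by (intro nn_integral_cong, subst nn_integral_cmult) (auto simp: inner)
  also have "\<dots> = (\<integral>\<^sup>+x. ennreal (10 * p / (p - 1) * 2 powr (p - 1) * \<bar>f x\<bar> powr p) \<partial>lborel)"
  proof (rule nn_integral_cong)
    fix x
    have "\<bar>f x\<bar> * \<bar>f x\<bar> powr (p - 1) = \<bar>f x\<bar> powr p"
      by (cases "f x = 0") (auto simp: powr_diff)
    then have "\<bar>f x\<bar> * (10 * p / (p - 1) * (2 * \<bar>f x\<bar>) powr (p - 1)) = 10 * p / (p - 1) * 2 powr (p - 1) * \<bar>f x\<bar> powr p"
      by (simp add: powr_mult)
    then show "ennreal \<bar>f x\<bar> * ennreal (10 * p / (p - 1) * (2 * \<bar>f x\<bar>) powr (p - 1)) = ennreal (10 * p / (p - 1) * 2 powr (p - 1) * \<bar>f x\<bar> powr p)"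
      using p by (simp add: ennreal_mult[symmetric])
  qed
  also have "\<dots> = ennreal (10 * p / (p - 1) * 2 powr (p - 1) * (\<integral>x. \<bar>f x\<bar> powr p \<partial>lborel))"
    using int p by (subst nn_integral_eq_integral) auto
  finally have H_le: "(\<integral>\<^sup>+x. H x \<partial>lborel) \<le> ennreal (10 * p / (p - 1) * 2 powr (p - 1) * (\<integral>x. \<bar>f x\<bar> powr p \<partial>lborel))" .
  then have "AE x in lborel. H x \<noteq> \<infinity>"
    by (intro nn_integral_noteq_infinite) (auto simp: top_unique)
  then show "AE x in lborel. F x < top"
  proof eventually_elim
    case (elim x)
    then obtain h where h: "H x = ennreal h" "0 \<le> h" by (cases "H x") auto
    show ?case
    proof (rule ccontr)
      assume "\<not> F x < top"
      \<comment> \<open>Every real level lies below \<open>F x = top\<close>; the level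
        \<open>(h + 1) powr (1 / p)\<close> gives the contradiction
        \<open>h + 1 \<le> h\<close>.\<close>
      then have "ennreal (((h + 1) powr (1 / p)) powr p) \<le> H x"
        by (intro H_ge) (auto simp: not_less top_unique)
      then show False
        using h p by (simp add: powr_powr)
    qed
  qed
  have "(\<integral>\<^sup>+x. ennreal (enn2real (F x) powr p) \<partial>lborel) \<le> (\<integral>\<^sup>+x. H x \<partial>lborel)"
    \<comment> \<open>\<open>enn2real\<close> sends \<open>top\<close> to 0, so its value never
      exceeds \<open>F x\<close>.\<close>
    by (intro nn_integral_mono H_ge) (auto simp: ennreal_enn2real_if)
  with H_le show "(\<integral>\<^sup>+x. ennreal (enn2real (F x) powr p) \<partial>lborel)
      \<le> ennreal (10 * p / (p - 1) * 2 powr (p - 1) * (\<integral>x. \<bar>f x\<bar> powr p \<partial>lborel))"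
    by (rule order_trans[rotated])
qed

subsection \<open>The maximal operator of the stable densities\<close>

text \<open>Continuity of every single convolution makes the supremum over uncountably many kernels
  lower semicontinuous, hence Borel.\<close>

lemma continuous_conv:
  fixes k f :: "real \<Rightarrow> real"
  assumes cont: "continuous_on UNIV k" and nonneg: "\<And>x. 0 \<le> k x"
    and decr: "\<And>x y. \<bar>x\<bar> \<le> \<bar>y\<bar> \<Longrightarrow> k y \<le> k x"
    and k_int: "integrable lborel k"
    and [measurable]: "f \<in> borel_measurable borel"
    and p: "1 \<le> p" and f_int: "integrable lborel (\<lambda>x. \<bar>f x\<bar> powr p)"
  shows "continuous_on UNIV (conv k f)"
proof (rule continuous_at_imp_continuous_on, rule ballI)
  fix x :: real
  have [measurable]: "k \<in> borel_measurable borel"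
    using cont by (rule borel_measurable_continuous_onI)
  \<comment> \<open>\<open>D\<close> dominates all shifts of \<open>k\<close> by at most \<open>1\<close>, which permits dominated convergence.\<close>
  define D where "D z = k 0 * indicator {-1..1} z + k (z - 1) + k (z + 1)" for z
  have [measurable]: "D \<in> borel_measurable borel" unfolding D_def by measurable
  have D_nonneg: "0 \<le> D z" for z
    using nonneg by (simp add: D_def indicator_def)
  have D_bound: "D z \<le> 3 * k 0" for z
    using nonneg[of 0] decr[of 0 "z - 1"] decr[of 0 "z + 1"] by (auto simp: D_def indicator_def)
  have k_le_D: "k w \<le> D z" if "\<bar>w - z\<bar> \<le> 1" for w z
  proof -
    consider "\<bar>z\<bar> \<le> 1" | "1 < z" | "z < -1" by linarith
    then show ?thesis
    proof cases
      case 1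
      then show ?thesis
        using decr[of 0 w] nonneg[of "z - 1"] nonneg[of "z + 1"] by (auto simp: D_def indicator_def)
    next
      case 2
      then have "k w \<le> k (z - 1)"
        using that by (intro decr) linarith
      with 2 show ?thesis
        using nonneg[of "z - 1"] nonneg[of "z + 1"] by (auto simp: D_def indicator_def)
    next
      case 3
      then have "k w \<le> k (z + 1)"
        using that by (intro decr) linarith
      with 3 show ?thesis
        using nonneg[of "z - 1"] nonneg[of "z + 1"] by (auto simp: D_def indicator_def)
    qed
  qed
  have ind: "integrable lborel (indicat_real {-1..1 :: real})"
    by (intro integrable_real_indicator) auto
  have D_int: "integrable lborel D"
    unfolding D_def
    using lborel_integrable_real_affine[OF k_int, of 1 "-1"] lborel_integrable_real_affine[OF k_int, of 1 1] ind
    by (intro Bochner_Integration.integrable_add) (auto simp: add.commute)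
  \<comment> \<open>The majorant splits by
    \<open>\<bar>f t\<bar> \<le> 1 + \<bar>f t\<bar> powr p\<close>: integrability of
    \<open>D\<close> handles the constant, boundedness of \<open>D\<close> the power.\<close>
  have w1: "integrable lborel (\<lambda>t. D (x - t))"
    using lborel_integrable_real_affine[OF D_int, of "-1" x] by simp
  have w2: "integrable lborel (\<lambda>t. D (x - t) * \<bar>f t\<bar> powr p)"
  proof (rule Bochner_Integration.integrable_bound)
    show "integrable lborel (\<lambda>t. 3 * k 0 * \<bar>f t\<bar> powr p)" using f_int by simp
    show "AE t in lborel. norm (D (x - t) * \<bar>f t\<bar> powr p) \<le> norm (3 * k 0 * \<bar>f t\<bar> powr p)"
      using D_nonneg D_bound nonneg[of 0]
      by (intro always_eventually allI) (auto simp: abs_mult intro!: mult_right_mono)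
  qed measurable
  have w: "integrable lborel (\<lambda>t. D (x - t) * (1 + \<bar>f t\<bar> powr p))"
    using Bochner_Integration.integrable_add[OF w1 w2] by (simp add: distrib_left)
  have f_le: "\<bar>f t\<bar> \<le> 1 + \<bar>f t\<bar> powr p" for t
  proof (cases "\<bar>f t\<bar> \<le> 1")
    case False
    then have "\<bar>f t\<bar> powr 1 \<le> \<bar>f t\<bar> powr p" using p by (intro powr_mono) auto
    with False show ?thesis by simp
  qed (simp add: add_increasing2)
  have seq: "(\<lambda>n. conv k f (X n)) \<longlonglongrightarrow> conv k f x" if X: "X \<longlonglongrightarrow> x" for X
  proof -
    obtain N where N: "\<And>n. N \<le> n \<Longrightarrow> dist (X n) x < 1"
      using X unfolding lim_sequentially by (metis zero_less_one)
    have "(\<lambda>n. conv k f (X (n + N))) \<longlonglongrightarrow> conv k f x"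
      unfolding conv_def
    proof (rule integral_dominated_convergence[OF _ _ w])
      have "isCont k z" for z
        using cont by (simp add: continuous_on_eq_continuous_at)
      then have "(\<lambda>n. k (X (n + N) - t)) \<longlonglongrightarrow> k (x - t)" for t
        by (intro isCont_tendsto_compose[of _ k] tendsto_intros LIMSEQ_ignore_initial_segment X)
      then show "AE t in lborel. (\<lambda>n. k (X (n + N) - t) * f t) \<longlonglongrightarrow> k (x - t) * f t"
        by (intro always_eventually allI tendsto_mult tendsto_const)
      show "AE t in lborel. norm (k (X (n + N) - t) * f t) \<le> D (x - t) * (1 + \<bar>f t\<bar> powr p)" for n
      proof (intro always_eventually allI)
        fix t
        have "k (X (n + N) - t) \<le> D (x - t)"
          using N[of "n + N"] by (intro k_le_D) (auto simp: dist_real_def)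
        then show "norm (k (X (n + N) - t) * f t) \<le> D (x - t) * (1 + \<bar>f t\<bar> powr p)"
          using nonneg D_nonneg f_le by (auto simp: abs_mult intro!: mult_mono)
      qed
    qed measurable
    then show ?thesis by (rule LIMSEQ_offset)
  qed
  then show "isCont (conv k f) x"
    unfolding isCont_def tendsto_at_iff_sequentially comp_def by blast
qed

text \<open>If the integrand is not integrable, \<open>conv\<close> takes the default value 0 and
  the bound is trivial.\<close>

lemma abs_conv_le_nn_integral:
  assumes [measurable]: "k \<in> borel_measurable borel" "f \<in> borel_measurable borel"
    and nonneg: "\<And>x. 0 \<le> k x"
  shows "ennreal \<bar>conv k f x\<bar> \<le> (\<integral>\<^sup>+t. ennreal (k (x - t)) * ennreal \<bar>f t\<bar> \<partial>lborel)"
proof (cases "integrable lborel (\<lambda>t. k (x - t) * f t)")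
  case True
  then have "ennreal \<bar>conv k f x\<bar> \<le> (\<integral>\<^sup>+t. ennreal (norm (k (x - t) * f t)) \<partial>lborel)"
    unfolding conv_def real_norm_def[symmetric] by (rule integral_norm_bound_ennreal)
  also have "\<dots> = (\<integral>\<^sup>+t. ennreal (k (x - t)) * ennreal \<bar>f t\<bar> \<partial>lborel)"
    using nonneg by (intro nn_integral_cong) (simp add: abs_mult ennreal_mult)
  finally show ?thesis .
qed (simp add: conv_def not_integrable_integral_eq)

lemma conv_cong_AE:
  assumes [measurable]: "g \<in> borel_measurable borel" "h \<in> borel_measurable borel" "f \<in> borel_measurable borel"
    and eq: "AE z in lborel. g z = h z" and "0 < y"
  shows "conv (dilate g y) f x = conv (dilate h y) f x"
  unfolding conv_def
proof (rule integral_cong_AE)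
  have "AE t in lborel. g (x / y + (- (1 / y)) * t) = h (x / y + (- (1 / y)) * t)"
    using \<open>0 < y\<close> eq by (intro AE_borel_affine) auto
  then show "AE t in lborel. dilate g y (x - t) * f t = dilate h y (x - t) * f t"
    by eventually_elim (simp add: dilate_def diff_divide_distrib)
qed (unfold dilate_def, measurable)

lemma
  assumes \<sigma>: "0 < \<sigma>" "\<sigma> < 2" and y: "0 < y"
  shows dilate_stable_kernel_nonneg: "0 \<le> dilate (stable_kernel \<sigma>) y x"
    and dilate_stable_kernel_antimono:
      "\<bar>x\<bar> \<le> \<bar>x'\<bar> \<Longrightarrow> dilate (stable_kernel \<sigma>) y x' \<le> dilate (stable_kernel \<sigma>) y x"
    and continuous_dilate_stable_kernel: "continuous_on UNIV (dilate (stable_kernel \<sigma>) y)"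
proof -
  show "0 \<le> dilate (stable_kernel \<sigma>) y x"
    using stable_kernel_nonneg[OF \<sigma>] y by (simp add: dilate_def)
  show "dilate (stable_kernel \<sigma>) y x' \<le> dilate (stable_kernel \<sigma>) y x" if "\<bar>x\<bar> \<le> \<bar>x'\<bar>"
    using y that unfolding dilate_def
    by (intro mult_left_mono stable_kernel_antimono[OF \<sigma>]) (auto simp: abs_divide divide_right_mono)
  show "continuous_on UNIV (dilate (stable_kernel \<sigma>) y)"
    unfolding dilate_def[abs_def]
    using y by (intro continuous_intros continuous_on_compose2[OF continuous_stable_kernel[OF \<sigma>(1)]]) auto
qed

lemma nn_integral_dilate_stable_kernel:
  assumes g: "stable_density \<sigma> g" and \<sigma>: "0 < \<sigma>" "\<sigma> < 2" and y: "0 < y"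
  shows "(\<integral>\<^sup>+x. ennreal (dilate (stable_kernel \<sigma>) y x) \<partial>lborel) = 1"
proof -
  have [measurable]: "stable_kernel \<sigma> \<in> borel_measurable borel"
    using continuous_stable_kernel[OF \<sigma>(1)] by (rule borel_measurable_continuous_onI)
  have "(\<integral>\<^sup>+x. ennreal (stable_kernel \<sigma> x) \<partial>lborel) = (\<integral>\<^sup>+x. ennreal (g x) \<partial>lborel)"
    using stable_density_AE_eq_stable_kernel[OF g \<sigma>]
    by (intro nn_integral_cong_AE) (auto elim: eventually_mono)
  also have "\<dots> = 1"
    using g by (subst nn_integral_eq_integral) (auto simp: stable_density_def)
  finally have "1 = (\<integral>\<^sup>+x. ennreal (stable_kernel \<sigma> x) \<partial>lborel)" ..
  also have "\<dots> = ennreal \<bar>1 / y\<bar> * (\<integral>\<^sup>+x. ennreal (stable_kernel \<sigma> (0 + 1 / y * x)) \<partial>lborel)"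
    using y by (intro nn_integral_real_affine) auto
  also have "\<dots> = (\<integral>\<^sup>+x. ennreal (dilate (stable_kernel \<sigma>) y x) \<partial>lborel)"
    using y stable_kernel_nonneg[OF \<sigma>]
    by (subst nn_integral_cmult[symmetric]) (auto simp: dilate_def ennreal_mult[symmetric] intro!: nn_integral_cong)
  finally show ?thesis ..
qed

context
  fixes L :: "real \<Rightarrow> real \<Rightarrow> real"
  assumes L: "\<And>\<sigma>. 0 < \<sigma> \<Longrightarrow> \<sigma> < 2 \<Longrightarrow> stable_density \<sigma> (L \<sigma>)"
begin

text \<open>A convolution does not see changes of its kernel on null sets, so the replacement is
  exact at every \<open>x\<close> and no uncountable union of exceptional sets arises.\<close>

lemma Lstar_eq_stable_kernel:
  assumes [measurable]: "f \<in> borel_measurable borel"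
  shows "Lstar L f x = (SUP q \<in> {0<..} \<times> {0<..<2}. ennreal \<bar>conv (dilate (stable_kernel (snd q)) (fst q)) f x\<bar>)"
  unfolding Lstar_def
proof (rule SUP_cong)
  fix q :: "real \<times> real" assume "q \<in> {0<..} \<times> {0<..<2}"
  then have q: "0 < fst q" "0 < snd q" "snd q < 2" by auto
  have "L (snd q) \<in> borel_measurable borel"
    using L[OF q(2,3)] by (simp add: stable_density_def)
  moreover have "stable_kernel (snd q) \<in> borel_measurable borel"
    using continuous_stable_kernel[OF q(2)] by (rule borel_measurable_continuous_onI)
  ultimately have "conv (dilate (L (snd q)) (fst q)) f x = conv (dilate (stable_kernel (snd q)) (fst q)) f x"
    using stable_density_AE_eq_stable_kernel[OF L[OF q(2,3)] q(2,3)] q(1) by (intro conv_cong_AE) auto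
  then show "ennreal \<bar>conv (dilate (L (snd q)) (fst q)) f x\<bar> = ennreal \<bar>conv (dilate (stable_kernel (snd q)) (fst q)) f x\<bar>"
    by simp
qed simp

lemma Lstar_le_hl_maximal:
  assumes [measurable]: "f \<in> borel_measurable borel"
  shows "Lstar L f x \<le> hl_maximal (\<lambda>x. ennreal \<bar>f x\<bar>) x"
  unfolding Lstar_eq_stable_kernel[OF assms]
proof (rule SUP_least)
  fix q :: "real \<times> real" assume "q \<in> {0<..} \<times> {0<..<2}"
  then have q: "0 < fst q" "0 < snd q" "snd q < 2" by auto
  let ?k = "dilate (stable_kernel (snd q)) (fst q)"
  have k [measurable]: "?k \<in> borel_measurable borel"
    using continuous_dilate_stable_kernel[OF q(2,3,1)] by (rule borel_measurable_continuous_onI)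
  have one: "(\<integral>\<^sup>+x. ennreal (?k x) \<partial>lborel) = 1"
    using nn_integral_dilate_stable_kernel[OF L[OF q(2,3)] q(2,3,1)] .
  have "ennreal \<bar>conv ?k f x\<bar> \<le> (\<integral>\<^sup>+t. ennreal (?k (x - t)) * ennreal \<bar>f t\<bar> \<partial>lborel)"
    using dilate_stable_kernel_nonneg[OF q(2,3,1)] by (intro abs_conv_le_nn_integral) auto
  also have "\<dots> \<le> (\<integral>\<^sup>+x. ennreal (?k x) \<partial>lborel) * hl_maximal (\<lambda>x. ennreal \<bar>f x\<bar>) x"
    using dilate_stable_kernel_antimono[OF q(2,3,1)] one
    by (intro radially_decreasing_conv_le_hl_maximal) auto
  finally show "ennreal \<bar>conv ?k f x\<bar> \<le> hl_maximal (\<lambda>x. ennreal \<bar>f x\<bar>) x"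
    by (simp add: one)
qed

lemma Lstar_le_bound:
  assumes [measurable]: "f \<in> borel_measurable borel" and M: "AE x in lborel. \<bar>f x\<bar> \<le> M"
  shows "Lstar L f x \<le> ennreal M"
  unfolding Lstar_eq_stable_kernel[OF assms(1)]
proof (rule SUP_least)
  fix q :: "real \<times> real" assume "q \<in> {0<..} \<times> {0<..<2}"
  then have q: "0 < fst q" "0 < snd q" "snd q < 2" by auto
  let ?k = "dilate (stable_kernel (snd q)) (fst q)"
  have k [measurable]: "?k \<in> borel_measurable borel"
    using continuous_dilate_stable_kernel[OF q(2,3,1)] by (rule borel_measurable_continuous_onI)
  have "ennreal \<bar>conv ?k f x\<bar> \<le> (\<integral>\<^sup>+t. ennreal (?k (x - t)) * ennreal \<bar>f t\<bar> \<partial>lborel)"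
    using dilate_stable_kernel_nonneg[OF q(2,3,1)] by (intro abs_conv_le_nn_integral) auto
  also have "\<dots> \<le> (\<integral>\<^sup>+t. ennreal (?k (x - t)) * ennreal M \<partial>lborel)"
    using M by (intro nn_integral_mono_AE) (auto elim!: eventually_mono intro!: mult_left_mono ennreal_leI)
  also have "\<dots> = (\<integral>\<^sup>+t. ennreal (?k (x + (-1) * t)) \<partial>lborel) * ennreal M"
    by (subst nn_integral_multc) auto
  also have "(\<integral>\<^sup>+t. ennreal (?k (x + (-1) * t)) \<partial>lborel) = (\<integral>\<^sup>+z. ennreal (?k z) \<partial>lborel)"
    by (subst nn_integral_real_affine[where c = "-1" and t = x]) auto
  also have "\<dots> = 1"
    using nn_integral_dilate_stable_kernel[OF L[OF q(2,3)] q(2,3,1)] .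
  finally show "ennreal \<bar>conv ?k f x\<bar> \<le> ennreal M"
    by simp
qed

text \<open>Each superlevel set is a union of open sets, one for each pair of scale and
  index.\<close>

lemma measurable_Lstar:
  assumes [measurable]: "f \<in> borel_measurable borel"
    and p: "1 \<le> p" and f_int: "integrable lborel (\<lambda>x. \<bar>f x\<bar> powr p)"
  shows "Lstar L f \<in> borel_measurable borel"
proof (rule borel_measurableI_greater)
  fix a :: ennreal
  let ?c = "\<lambda>q. conv (dilate (stable_kernel (snd q)) (fst q)) f"
  have cont: "continuous_on UNIV (?c q)" if "q \<in> {0<..} \<times> {0<..<2}" for q
  proof (rule continuous_conv[OF _ _ _ _ assms])
    have q: "0 < fst q" "0 < snd q" "snd q < 2" using that by auto
    note props = dilate_stable_kernel_nonneg[OF q(2,3,1)] dilate_stable_kernel_antimono[OF q(2,3,1)]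
      continuous_dilate_stable_kernel[OF q(2,3,1)]
    show "integrable lborel (dilate (stable_kernel (snd q)) (fst q))"
    proof (rule integrableI_nonneg)
      show "(\<integral>\<^sup>+x. ennreal (dilate (stable_kernel (snd q)) (fst q) x) \<partial>lborel) < \<infinity>"
        using nn_integral_dilate_stable_kernel[OF L[OF q(2,3)] q(2,3,1)] by simp
    qed (use props in \<open>auto intro: borel_measurable_continuous_onI\<close>)
  qed (use that in \<open>auto intro: dilate_stable_kernel_nonneg dilate_stable_kernel_antimono continuous_dilate_stable_kernel\<close>)
  have "open {x. a < Lstar L f x}"
  proof -
    have "{x. a < Lstar L f x} = (\<Union>q\<in>{0<..} \<times> {0<..<2}. {x. a < ennreal \<bar>?c q x\<bar>})"
      unfolding Lstar_eq_stable_kernel[OF assms(1)] less_SUP_iff by blast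
    moreover have "open {x. a < ennreal \<bar>?c q x\<bar>}" if "q \<in> {0<..} \<times> {0<..<2}" for q
      by (intro open_Collect_less continuous_on_const continuous_on_ennreal continuous_on_rabs cont[OF that])
    ultimately show ?thesis by (metis (no_types, lifting) open_UN)
  qed
  then show "{x \<in> space borel. a < Lstar L f x} \<in> sets borel"
    by simp
qed

end

section \<open>The weak type, strong type and bounded-function estimates\<close>

theorem theorem2p2:
  fixes L :: "real \<Rightarrow> real \<Rightarrow> real"
  assumes L: "\<And>\<sigma>. 0 < \<sigma> \<Longrightarrow> \<sigma> < 2 \<Longrightarrow> stable_density \<sigma> (L \<sigma>)"
  shows
    "(\<exists>C>0. \<forall>f. integrable lborel f \<longrightarrow> (\<forall>t>0.
        {x. Lstar L f x > ennreal t} \<in> sets lborel \<and>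
        emeasure lborel {x. Lstar L f x > ennreal t}
          \<le> ennreal (C / t * (\<integral>x. \<bar>f x\<bar> \<partial>lborel))))
     \<and> (\<forall>p::real. 1 < p \<longrightarrow> (\<exists>C>0. \<forall>f. f \<in> borel_measurable lborel \<longrightarrow>
          integrable lborel (\<lambda>x. \<bar>f x\<bar> powr p) \<longrightarrow>
          Lstar L f \<in> borel_measurable lborel \<and>
          (AE x in lborel. Lstar L f x < top) \<and>
          (\<integral>\<^sup>+x. ennreal (enn2real (Lstar L f x) powr p) \<partial>lborel)
            \<le> ennreal (C powr p * (\<integral>x. \<bar>f x\<bar> powr p \<partial>lborel))))
     \<and> (\<exists>C>0. \<forall>f M. f \<in> borel_measurable lborel \<longrightarrow>
          (AE x in lborel. \<bar>f x\<bar> \<le> M) \<longrightarrow>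
          (AE x in lborel. Lstar L f x \<le> ennreal (C * M)))"
proof (intro conjI allI impI)
  show "\<exists>C>0. \<forall>f. integrable lborel f \<longrightarrow> (\<forall>t>0.
        {x. Lstar L f x > ennreal t} \<in> sets lborel \<and>
        emeasure lborel {x. Lstar L f x > ennreal t}
          \<le> ennreal (C / t * (\<integral>x. \<bar>f x\<bar> \<partial>lborel)))"
  \<comment> \<open>The constant 5 is the Vitali enlargement factor.\<close>
  proof (intro exI[of _ 5] conjI allI impI)
    fix f :: "real \<Rightarrow> real" and t :: real
    assume f: "integrable lborel f" and t: "0 < t"
    have [measurable]: "f \<in> borel_measurable borel" using f by auto
    have [measurable]: "Lstar L f \<in> borel_measurable borel"
      using f by (intro measurable_Lstar[OF L, of f 1]) auto
    show "{x. Lstar L f x > ennreal t} \<in> sets lborel" by measurable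
    have int: "(\<integral>\<^sup>+x. ennreal \<bar>f x\<bar> \<partial>lborel) = ennreal (\<integral>x. \<bar>f x\<bar> \<partial>lborel)"
      using f by (intro nn_integral_eq_integral) auto
    obtain W where W: "W \<in> sets borel" "{x. ennreal t < hl_maximal (\<lambda>x. ennreal \<bar>f x\<bar>) x} \<subseteq> W"
      "emeasure lborel W \<le> ennreal (5 / t) * (\<integral>\<^sup>+x. ennreal \<bar>f x\<bar> \<partial>lborel)"
      using hl_maximal_weak_type[of "\<lambda>x. ennreal \<bar>f x\<bar>" t] t by (auto simp: int)
    have "{x. Lstar L f x > ennreal t} \<subseteq> W"
      using W(2) Lstar_le_hl_maximal[OF L, of f] by (auto intro: less_le_trans)
    then have "emeasure lborel {x. Lstar L f x > ennreal t} \<le> emeasure lborel W"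
      using W(1) by (intro emeasure_mono) auto
    also note W(3)
    also have "ennreal (5 / t) * (\<integral>\<^sup>+x. ennreal \<bar>f x\<bar> \<partial>lborel) = ennreal (5 / t * (\<integral>x. \<bar>f x\<bar> \<partial>lborel))"
      unfolding int using t by (intro ennreal_mult[symmetric]) auto
    finally show "emeasure lborel {x. Lstar L f x > ennreal t} \<le> ennreal (5 / t * (\<integral>x. \<bar>f x\<bar> \<partial>lborel))" .
  qed simp
next
  fix p :: real assume p: "1 < p"
  \<comment> \<open>\<open>K\<close> bounds the integral of the p-th power, so the constant for the
    norm is its p-th root.\<close>
  define K where "K = 10 * p / (p - 1) * 2 powr (p - 1)"
  have K: "0 < K" using p by (simp add: K_def)
  then have K_powr: "(K powr (1 / p)) powr p = K" using p by (simp add: powr_powr)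
  show "\<exists>C>0. \<forall>f. f \<in> borel_measurable lborel \<longrightarrow>
          integrable lborel (\<lambda>x. \<bar>f x\<bar> powr p) \<longrightarrow>
          Lstar L f \<in> borel_measurable lborel \<and>
          (AE x in lborel. Lstar L f x < top) \<and>
          (\<integral>\<^sup>+x. ennreal (enn2real (Lstar L f x) powr p) \<partial>lborel)
            \<le> ennreal (C powr p * (\<integral>x. \<bar>f x\<bar> powr p \<partial>lborel))"
  proof (intro exI[of _ "K powr (1 / p)"] conjI allI impI)
    fix f :: "real \<Rightarrow> real"
    assume "f \<in> borel_measurable lborel" and f_int: "integrable lborel (\<lambda>x. \<bar>f x\<bar> powr p)"
    then have f: "f \<in> borel_measurable borel" by simp
    have meas: "Lstar L f \<in> borel_measurable borel"
      using p by (intro measurable_Lstar[OF L f _ f_int]) auto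
    then show "Lstar L f \<in> borel_measurable lborel" by simp
    note strong = strong_type_of_le_hl_maximal[OF f meas Lstar_le_hl_maximal[OF L f] p f_int]
    show "AE x in lborel. Lstar L f x < top"
      by (rule strong(1))
    show "(\<integral>\<^sup>+x. ennreal (enn2real (Lstar L f x) powr p) \<partial>lborel)
            \<le> ennreal ((K powr (1 / p)) powr p * (\<integral>x. \<bar>f x\<bar> powr p \<partial>lborel))"
      unfolding K_powr unfolding K_def by (rule strong(2))
  qed (use K in simp)
next
  show "\<exists>C>0. \<forall>f M. f \<in> borel_measurable lborel \<longrightarrow>
          (AE x in lborel. \<bar>f x\<bar> \<le> M) \<longrightarrow>
          (AE x in lborel. Lstar L f x \<le> ennreal (C * M))"
    \<comment> \<open>The kernels have mass 1, which gives \<open>C = 1\<close> and a bound at every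
      point.\<close>
    using Lstar_le_bound[OF L] by (intro exI[of _ 1]) auto
qed

end
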